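(* Let $\mu$ be an element of the positive root lattice of $\mathfrak{sl}_n(\mathbb C)$. Let $\lambda$ be a dominant integral weight so large that $(\mathcal L_{\mathbb Z}(\infty))_{-\mu}$ can be identified with $(\mathcal L_{\mathbb Z}(\lambda))_{\lambda-\mu}$ (via $u\mapsto uv_\lambda$), and the standard tableaux of shape $\lambda$ and weight $\mu$ are all special. Let $\lambda'$ be another such weight, and let $\sigma\leftrightarrow\sigma'$ denote the bijective correspondence between standard tableaux of weight $\mu$ of shape $\lambda$ on the one hand and of shape $\lambda'$ on the other (characterized by $a_k^r(\sigma)=a_k^r(\sigma')$ for all $1\le k\le r\le \ell$). Then $v_\sigma^{**}=v_{\sigma'}^{**}$ as elements of $(\mathcal L_{\mathbb Z}(\infty))_{-\mu}$.
   Context: Fix $n\ge 2$, $\ell=n-1$, $\mathfrak g=\mathfrak{sl}_n(\mathbb C)$, simple roots $\alpha_i=\epsilon_i-\epsilon_{i+1}$ and fundamental weights $\varpi_i=\epsilon_1+\dots+\epsilon_i$ ($1\le i\le\ell$). The positive root lattice is $\sum_i\mathbb Z_{\ge0}\alpha_i$. **Tableaux.** Let $\lambda=(m_1,\dots,m_\ell)$ be a tuple of non-negative integers, identified with the dominant weight $\sum m_i\varpi_i$. The shape $\lambda$ has $m:=m_1+\dots+m_\ell$ top-justified columns, numbered from left to right: the first $m_1$ columns have 1 box, the next $m_2$ have 2 boxes, and so on. A tableau of shape $\lambda$ is a filling of the boxes by integers in $\{1,\dots,n\}$ that is strictly increasing down each column. It is standard if the entries in each row are non-increasing from left to right. It is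 special if every entry on row $r$ that is greater than $r$ is the last entry of its column. For a tableau $\sigma$ and $1\le k\le r\le\ell$ let $a_k^r(\sigma)$ be the number of entries equal to $r+1$ in the top $k$ rows of $\sigma$; the weight of $\sigma$ is $\sum_{r,k}a_k^r(\sigma)\alpha_k$. **Quantum group.** $U_q(\mathfrak g)$ is the $\mathbb Q(q)$-algebra with generators $E_i,F_i,K_i^{\pm1}$, $1\le i\le\ell$, and the usual relations ($[E_i,F_j]=\delta_{ij}\frac{K_i-K_i^{-1}}{q-q^{-1}}$, $K_iF_jK_i^{-1}=q^{-(\alpha_i,\alpha_j)}F_j$, etc.). $U_q^-$ is the subalgebra generated by the $F_i$, $F_i^{(k)}=F_i^k/[k]!$ with $[k]=\frac{q^k-q^{-k}}{q-q^{-1}}$, and $U_{\mathbb Z}^-$ is the $\mathbb Z[q,q^{-1}]$-subalgebra generated by all $F_i^{(k)}$. $A\subset\mathbb Q(q)$ is the ring of fractions $f/g$ with $f,g\in\mathbb Q[q]$, $g(0)\neq0$. On a finite-dimensional (type 1) module, $\widetilde F_i$ is the Kashiwara operator: if $u=\sum_r F_i^{(r)}u_r$ with $u$ a weight vector, $u_r$ weight vectors and $E_iu_r=0$ (standard $\mathfrak{sl}_2$ decomposition) then $\widetilde F_iu=\sum_rF_i^{(r+1)}u_r$. On $U_q^-$, $\widetilde F_i$ is defined in the same way from $u=\sum_rF_i^{(r)}u_r$ with $e_i'(u_r)=0$, where $e_i'$ is the linear map with $e_i'(1)=0$, $e_i'(F_ju)=\delta_{ij}u+q^{-(\alpha_i,\alpha_j)}F_je_i'(u)$.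 The crystal lattice $\mathcal L(\infty)$ is the $A$-span in $U_q^-$ of all $\widetilde F_{i_1}\cdots\widetilde F_{i_s}\cdot1$, and $\mathcal L_{\mathbb Z}(\infty)=U_{\mathbb Z}^-\cap\mathcal L(\infty)$. **Modules.** $V(j)$ ($1\le j\le\ell$) is the fundamental module with basis $v_x=e_{i_1}\wedge\dots\wedge e_{i_j}$, $x$ running over single-column tableaux with entries $i_1<\dots<i_j$. For each $c$: $F_cv_x=v_z$, with $z$ obtained by replacing $c$ by $c+1$, if $c$ but not $c+1$ occurs in $x$, and $F_cv_x=0$ otherwise; $E_c$ acts by the reverse replacement; $K_cv_x$ equals $qv_x$, $q^{-1}v_x$, $v_x$ according as only $c$ occurs, only $c+1$ occurs, or both or neither occur. Let $v_j=e_1\wedge\dots\wedge e_j$. Tensor products use the comultiplication $\Delta'(F_i)=F_i\otimes1+K_i\otimes F_i$, $\Delta'(E_i)=E_i\otimes K_i^{-1}+1\otimes E_i$, $\Delta'(K_i)=K_i\otimes K_i$. For $\lambda=(m_1,\dots,m_\ell)$ put $V=V(1)^{\otimes m_1}\otimes\dots\otimes V(\ell)^{\otimes m_\ell}$, $v_\lambda=v_1^{\otimes m_1}\otimes\dots\otimes v_\ell^{\otimes m_\ell}$, and for a tableau $x$ of shape $\lambda$ with columns $x_1,\dots,x_m$ put $v_x=v_{x_1}\otimes\dots\otimes v_{x_m}$. The $v_x$ form a basis of $V$; let $v_x^*$ be the dual basis. $V(\lambda)=U_q^-v_\lambda\subset V$ is the simple module of highest weight $\lambda$; $V_{\mathbb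 Z}(\lambda)=U_{\mathbb Z}^-v_\lambda$; $\mathcal L(\lambda)$ is the $A$-span of all $\widetilde F_{i_1}\cdots\widetilde F_{i_s}v_\lambda$; $\mathcal L_{\mathbb Z}(\lambda)=V_{\mathbb Z}(\lambda)\cap\mathcal L(\lambda)$. Subscripts $-\mu$, $\lambda-\mu$ denote weight spaces. The identification of $(\mathcal L_{\mathbb Z}(\infty))_{-\mu}$ with $(\mathcal L_{\mathbb Z}(\lambda))_{\lambda-\mu}$ means that $u\mapsto uv_\lambda$ restricts to an isomorphism $(U_{\mathbb Z}^-)_{-\mu}\to(V_{\mathbb Z}(\lambda))_{\lambda-\mu}$ carrying the former lattice onto the latter. **The element $v_\sigma^{**}$.** The restrictions of the $v_\sigma^*$, $\sigma$ standard of shape $\lambda$, form a basis of the dual $\mathcal L_{\mathbb Z}(\lambda)^*$ over $\mathbb Z[q]$; $\{v_\sigma^{**}\}\subset\mathcal L_{\mathbb Z}(\lambda)$ is the dual basis, i.e. $v_\tau^*(v_\sigma^{**})=\delta_{\sigma\tau}$ for all standard $\sigma,\tau$ of shape $\lambda$. For $\sigma$ of weight $\mu$, $v_\sigma^{**}$ lies in $(\mathcal L_{\mathbb Z}(\lambda))_{\lambda-\mu}$ and is regarded as an element of $(\mathcal L_{\mathbb Z}(\infty))_{-\mu}$ by the identification above. Similarly for $\lambda'$. *)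

theory Defs
  imports
    "HOL-Library.Poly_Mapping"
    "HOL-Library.FuncSet"
    "HOL-Computational_Algebra.Polynomial"
    "HOL-Computational_Algebra.Fraction_Field"
    "HOL-Algebra.QuotRing"
    "HOL-Algebra.Generated_Rings"
begin

text \<open>
  Throughout, the Lie algebra is sl_n with n at least 2, and all indices i of simple roots,
  fundamental weights and Chevalley generators range over \<open>{1..<n}\<close>, that is, from 1 to n - 1.
  An element of the positive root lattice, and likewise a dominant weight, is given by its
  coordinates (with respect to the simple roots, respectively the fundamental weights) as a
  function \<^typ>\<open>nat \<Rightarrow> nat\<close> of which only the values on \<open>{1..<n}\<close> matter.
\<close>

section \<open>The field of rational functions in q and its subrings\<close>

type_synonym ratfun = "rat poly fract"

definition qq :: ratfun
  where "qq = Fract [:0, 1:] 1"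

definition qint :: "nat \<Rightarrow> ratfun"
  where "qint k = (qq ^ k - inverse qq ^ k) / (qq - inverse qq)"

definition qfact :: "nat \<Rightarrow> ratfun"
  where "qfact k = (\<Prod>j\<in>{1..k}. qint j)"

text \<open>The ring Z[q, 1/q] of integral Laurent polynomials.\<close>

definition laurent_ring :: "ratfun set"
  where "laurent_ring = {Fract (map_poly rat_of_int p) (Polynomial.monom 1 k) | p k. True}"

text \<open>The ring A of rational functions regular at q = 0.\<close>

definition regular_ring :: "ratfun set"
  where "regular_ring = {Fract f g | f g. poly g 0 \<noteq> 0}"

text \<open>The span of \<open>S\<close> over a set \<open>R\<close> of scalars (here always a subring of the field).\<close>

inductive_set span_over :: "'v \<Rightarrow> ('v \<Rightarrow> 'v \<Rightarrow> 'v) \<Rightarrow> ('c \<Rightarrow> 'v \<Rightarrow> 'v) \<Rightarrow> 'c set \<Rightarrow> 'v set \<Rightarrow> 'v set"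
  for z :: 'v and add :: "'v \<Rightarrow> 'v \<Rightarrow> 'v" and scale :: "'c \<Rightarrow> 'v \<Rightarrow> 'v" and R :: "'c set" and S :: "'v set"
  where
    "z \<in> span_over z add scale R S"
  | "c \<in> R \<Longrightarrow> x \<in> S \<Longrightarrow> y \<in> span_over z add scale R S
      \<Longrightarrow> add (scale c x) y \<in> span_over z add scale R S"


section \<open>The root system\<close>

definition cartan :: "nat \<Rightarrow> nat \<Rightarrow> int"
  where "cartan i j = (if i = j then 2 else if i = Suc j \<or> j = Suc i then - 1 else 0)"

text \<open>The form of the simple root with index \<open>i\<close> with \<open>\<Sum>j. mu j * alpha_j\<close>.\<close>

definition root_pairing :: "nat \<Rightarrow> nat \<Rightarrow> (nat \<Rightarrow> nat) \<Rightarrow> int"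
  where "root_pairing n i mu = (\<Sum>j\<in>{1..<n}. int (mu j) * cartan i j)"


section \<open>The quantum group\<close>

text \<open>
  The quantum group is the quotient of the free algebra on the generators by the two-sided ideal
  generated by the defining relations. The free algebra consists of the finitely supported
  functions on the free monoid of words; words form a separate type because the convolution product
  of \<^typ>\<open>'a \<Rightarrow>\<^sub>0 'b\<close> requires the monoid to be written additively.
\<close>

datatype gen = GenE nat | GenF nat | GenK nat | GenKinv nat

primrec gen_index :: "gen \<Rightarrow> nat"
  where
    "gen_index (GenE i) = i"
  | "gen_index (GenF i) = i"
  | "gen_index (GenK i) = i"
  | "gen_index (GenKinv i) = i"

datatype 'g word = Word (letters: "'g list")

instantiation word :: (type) monoid_add
begin

definition zero_word :: "'a word"
  where "zero_word = Word []"

definition plus_word :: "'a word \<Rightarrow> 'a word \<Rightarrow> 'a word"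
  where "plus_word u v = Word (letters u @ letters v)"

instance
  by standard (simp_all add: zero_word_def plus_word_def)

end

type_synonym freealg = "gen word \<Rightarrow>\<^sub>0 ratfun"

definition scl :: "ratfun \<Rightarrow> freealg"
  where "scl c = Poly_Mapping.single 0 c"

definition var :: "gen \<Rightarrow> freealg"
  where "var g = Poly_Mapping.single (Word [g]) 1"

definition free_ring :: "nat \<Rightarrow> freealg ring"
  where "free_ring n =
    \<lparr>carrier = {p. \<forall>w\<in>Poly_Mapping.keys p. \<forall>g\<in>set (letters w). gen_index g \<in> {1..<n}},
     mult = (*), one = 1, zero = 0, add = (+)\<rparr>"

definition serre :: "(nat \<Rightarrow> gen) \<Rightarrow> nat \<Rightarrow> nat \<Rightarrow> freealg"
  where "serre X i j =
    (if cartan i j = 0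
     then var (X i) * var (X j) - var (X j) * var (X i)
     else var (X i) * var (X i) * var (X j)
          - scl (qint 2) * var (X i) * var (X j) * var (X i)
          + var (X j) * var (X i) * var (X i))"

definition uq_relators :: "nat \<Rightarrow> freealg set"
  where "uq_relators n =
    (\<Union>i\<in>{1..<n}. {var (GenK i) * var (GenKinv i) - 1, var (GenKinv i) * var (GenK i) - 1})
    \<union> (\<Union>i\<in>{1..<n}. \<Union>j\<in>{1..<n}.
        {var (GenK i) * var (GenK j) - var (GenK j) * var (GenK i),
         var (GenK i) * var (GenE j) * var (GenKinv i) - scl (qq powi cartan i j) * var (GenE j),
         var (GenK i) * var (GenF j) * var (GenKinv i) - scl (qq powi (- cartan i j)) * var (GenF j),
         var (GenE i) * var (GenF j) - var (GenF j) * var (GenE i)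
           - (if i = j then scl (1 / (qq - inverse qq)) * (var (GenK i) - var (GenKinv i)) else 0)})
    \<union> (\<Union>i\<in>{1..<n}. \<Union>j\<in>{1..<n} - {i}. {serre GenE i j, serre GenF i j})"

definition uq_ideal :: "nat \<Rightarrow> freealg set"
  where "uq_ideal n = genideal (free_ring n) (uq_relators n)"

type_synonym uq = "freealg set"

definition Uq :: "nat \<Rightarrow> uq ring"
  where "Uq n = free_ring n Quot uq_ideal n"

definition uq_class :: "nat \<Rightarrow> freealg \<Rightarrow> uq"
  where "uq_class n p = uq_ideal n +>\<^bsub>free_ring n\<^esub> p"

definition uq_scale :: "nat \<Rightarrow> ratfun \<Rightarrow> uq \<Rightarrow> uq"
  where "uq_scale n c u = uq_class n (scl c) \<otimes>\<^bsub>Uq n\<^esub> u"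

abbreviation uq_F :: "nat \<Rightarrow> nat \<Rightarrow> uq"
  where "uq_F n i \<equiv> uq_class n (var (GenF i))"

definition divF :: "nat \<Rightarrow> nat \<Rightarrow> nat \<Rightarrow> uq"
  where "divF n i k = uq_scale n (1 / qfact k) (uq_F n i [^]\<^bsub>Uq n\<^esub> k)"

text \<open>
  The subalgebra generated by \<open>H\<close> over a ring of (central) scalars is the subring generated
  by \<open>H\<close> together with these scalars.
\<close>

definition Uminus :: "nat \<Rightarrow> uq set"
  where "Uminus n = generate_ring (Uq n)
    (range (\<lambda>c. uq_class n (scl c)) \<union> uq_F n ` {1..<n})"

definition UminusZ :: "nat \<Rightarrow> uq set"
  where "UminusZ n = generate_ring (Uq n)
    ((\<lambda>c. uq_class n (scl c)) ` laurent_ring \<union> {divF n i k | i k. i \<in> {1..<n}})"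

text \<open>The weight \<open>nu\<close> is given by its pairings with the simple roots.\<close>

definition uq_has_weight :: "nat \<Rightarrow> (nat \<Rightarrow> int) \<Rightarrow> uq \<Rightarrow> bool"
  where "uq_has_weight n nu u \<longleftrightarrow>
    (\<forall>i\<in>{1..<n}. uq_class n (var (GenK i)) \<otimes>\<^bsub>Uq n\<^esub> u \<otimes>\<^bsub>Uq n\<^esub> uq_class n (var (GenKinv i))
      = uq_scale n (qq powi nu i) u)"


section \<open>The crystal lattice of the negative part\<close>

text \<open>The Kashiwara derivation, as a map on \<open>Uminus n\<close> (undefined elsewhere).\<close>

definition eprime :: "nat \<Rightarrow> nat \<Rightarrow> uq \<Rightarrow> uq"
  where "eprime n i = (THE e. e \<in> Uminus n \<rightarrow>\<^sub>E Uminus n \<and>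
    (\<forall>u\<in>Uminus n. \<forall>v\<in>Uminus n. e (u \<oplus>\<^bsub>Uq n\<^esub> v) = e u \<oplus>\<^bsub>Uq n\<^esub> e v) \<and>
    (\<forall>c. \<forall>u\<in>Uminus n. e (uq_scale n c u) = uq_scale n c (e u)) \<and>
    e \<one>\<^bsub>Uq n\<^esub> = \<zero>\<^bsub>Uq n\<^esub> \<and>
    (\<forall>j\<in>{1..<n}. \<forall>u\<in>Uminus n. e (uq_F n j \<otimes>\<^bsub>Uq n\<^esub> u) =
      (if i = j then u else \<zero>\<^bsub>Uq n\<^esub>)
        \<oplus>\<^bsub>Uq n\<^esub> uq_scale n (qq powi (- cartan i j)) (uq_F n j \<otimes>\<^bsub>Uq n\<^esub> e u)))"

definition kashiwara_inf :: "nat \<Rightarrow> nat \<Rightarrow> uq \<Rightarrow> uq"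
  where "kashiwara_inf n i u = (THE u'. \<exists>N us.
    (\<forall>r\<le>N. us r \<in> Uminus n \<and> (\<exists>nu. uq_has_weight n nu (us r)) \<and> eprime n i (us r) = \<zero>\<^bsub>Uq n\<^esub>) \<and>
    u = (\<Oplus>\<^bsub>Uq n\<^esub>r\<in>{..N}. divF n i r \<otimes>\<^bsub>Uq n\<^esub> us r) \<and>
    u' = (\<Oplus>\<^bsub>Uq n\<^esub>r\<in>{..N}. divF n i (Suc r) \<otimes>\<^bsub>Uq n\<^esub> us r))"

definition L_inf :: "nat \<Rightarrow> uq set"
  where "L_inf n = span_over \<zero>\<^bsub>Uq n\<^esub> (add (Uq n)) (uq_scale n) regular_ring
    {foldr (kashiwara_inf n) is \<one>\<^bsub>Uq n\<^esub> | is. is \<in> lists {1..<n}}"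

definition LZ_inf :: "nat \<Rightarrow> uq set"
  where "LZ_inf n = UminusZ n \<inter> L_inf n"

text \<open>The weight space of weight \<open>- mu\<close>.\<close>

definition uq_wt_space :: "nat \<Rightarrow> (nat \<Rightarrow> nat) \<Rightarrow> uq set"
  where "uq_wt_space n mu = {u. uq_has_weight n (\<lambda>i. - root_pairing n i mu) u}"


section \<open>Tableaux\<close>

text \<open>
  A tableau is the list of its columns from left to right, each column being listed from top to
  bottom. So the entry on row r (counted from 1) of column \<open>x\<close> is \<open>x ! (r - 1)\<close>.
\<close>

type_synonym tableau = "nat list list"

definition column_heights :: "nat \<Rightarrow> (nat \<Rightarrow> nat) \<Rightarrow> nat list"
  where "column_heights n lam = concat (map (\<lambda>j. replicate (lam j) j) [1..<n])"

definition tableaux :: "nat \<Rightarrow> (nat \<Rightarrow> nat) \<Rightarrow> tableau set"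
  where "tableaux n lam = {t. map length t = column_heights n lam \<and>
    (\<forall>x\<in>set t. set x \<subseteq> {1..n} \<and> sorted_wrt (<) x)}"

definition standard :: "tableau \<Rightarrow> bool"
  where "standard t \<longleftrightarrow> (\<forall>p p' r. p < p' \<and> p' < length t \<and> r < length (t ! p) \<and> r < length (t ! p')
    \<longrightarrow> t ! p' ! r \<le> t ! p ! r)"

definition special :: "tableau \<Rightarrow> bool"
  where "special t \<longleftrightarrow> (\<forall>x\<in>set t. \<forall>r<length x. x ! r > Suc r \<longrightarrow> Suc r = length x)"

text \<open>The number of entries r + 1 in the top k rows.\<close>

definition entry_count :: "nat \<Rightarrow> nat \<Rightarrow> tableau \<Rightarrow> nat"
  where "entry_count k r t = (\<Sum>x\<leftarrow>t. count_list (take k x) (Suc r))"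

definition has_tab_weight :: "nat \<Rightarrow> (nat \<Rightarrow> nat) \<Rightarrow> tableau \<Rightarrow> bool"
  where "has_tab_weight n mu t \<longleftrightarrow> (\<forall>k\<in>{1..<n}. (\<Sum>r\<in>{k..<n}. entry_count k r t) = mu k)"

definition std_tableaux :: "nat \<Rightarrow> (nat \<Rightarrow> nat) \<Rightarrow> tableau set"
  where "std_tableaux n lam = {t \<in> tableaux n lam. standard t}"


section \<open>The modules\<close>

text \<open>
  The vectors of the tensor product V of fundamental modules attached to \<open>lam\<close> are the formal
  linear combinations of the tableaux of shape \<open>lam\<close>, where \<open>Poly_Mapping.single x 1\<close> is the basis
  vector of \<open>x\<close> and \<open>Poly_Mapping.lookup v x\<close> is the value of the dual basis vector of \<open>x\<close> on \<open>v\<close>.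
\<close>

type_synonym vec = "tableau \<Rightarrow>\<^sub>0 ratfun"

definition vscale :: "ratfun \<Rightarrow> vec \<Rightarrow> vec"
  where "vscale c = Poly_Mapping.map ((*) c)"

definition lin_ext :: "(tableau \<Rightarrow> vec) \<Rightarrow> vec \<Rightarrow> vec"
  where "lin_ext f v = (\<Sum>x\<in>Poly_Mapping.keys v. vscale (Poly_Mapping.lookup v x) (f x))"

definition tensor_space :: "nat \<Rightarrow> (nat \<Rightarrow> nat) \<Rightarrow> vec set"
  where "tensor_space n lam = {v. Poly_Mapping.keys v \<subseteq> tableaux n lam}"

definition col_replace :: "nat \<Rightarrow> nat \<Rightarrow> nat list \<Rightarrow> nat list"
  where "col_replace a b x = map (\<lambda>t. if t = a then b else t) x"

definition K_col :: "nat \<Rightarrow> nat list \<Rightarrow> ratfun"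
  where "K_col c x =
    (if c \<in> set x \<and> Suc c \<notin> set x then qq
     else if Suc c \<in> set x \<and> c \<notin> set x then inverse qq else 1)"

definition K_tab :: "nat \<Rightarrow> tableau \<Rightarrow> ratfun"
  where "K_tab c t = (\<Prod>x\<leftarrow>t. K_col c x)"

text \<open>The tensor product of the basis vector of a column with a vector.\<close>

definition tensor_col :: "nat list \<Rightarrow> vec \<Rightarrow> vec"
  where "tensor_col x = lin_ext (\<lambda>t. Poly_Mapping.single (x # t) 1)"

text \<open>
  The actions of F and E on a basis vector, by the comultiplication
  \<open>F \<mapsto> F \<otimes> 1 + K \<otimes> F\<close>, \<open>E \<mapsto> E \<otimes> K\<^sup>-\<^sup>1 + 1 \<otimes> E\<close> applied to (first column) \<open>\<otimes>\<close> (remaining columns).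
\<close>

primrec F_tab :: "nat \<Rightarrow> tableau \<Rightarrow> vec"
  where
    "F_tab c [] = 0"
  | "F_tab c (x # t) =
      (if c \<in> set x \<and> Suc c \<notin> set x
       then Poly_Mapping.single (col_replace c (Suc c) x # t) 1 else 0)
      + vscale (K_col c x) (tensor_col x (F_tab c t))"

primrec E_tab :: "nat \<Rightarrow> tableau \<Rightarrow> vec"
  where
    "E_tab c [] = 0"
  | "E_tab c (x # t) =
      (if Suc c \<in> set x \<and> c \<notin> set x
       then vscale (inverse (K_tab c t)) (Poly_Mapping.single (col_replace (Suc c) c x # t) 1) else 0)
      + tensor_col x (E_tab c t)"

primrec gen_act :: "gen \<Rightarrow> vec \<Rightarrow> vec"
  where
    "gen_act (GenE i) = lin_ext (E_tab i)"
  | "gen_act (GenF i) = lin_ext (F_tab i)"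
  | "gen_act (GenK i) = lin_ext (\<lambda>t. Poly_Mapping.single t (K_tab i t))"
  | "gen_act (GenKinv i) = lin_ext (\<lambda>t. Poly_Mapping.single t (inverse (K_tab i t)))"

definition free_act :: "freealg \<Rightarrow> vec \<Rightarrow> vec"
  where "free_act p v =
    (\<Sum>w\<in>Poly_Mapping.keys p. vscale (Poly_Mapping.lookup p w) (foldr gen_act (letters w) v))"

text \<open>
  The action of an element of the quantum group, that is, of a coset, on a vector of some
  \<open>tensor_space n lam\<close>: all representatives of the coset act alike there.
\<close>

definition uq_act :: "uq \<Rightarrow> vec \<Rightarrow> vec"
  where "uq_act u v = the_elem ((\<lambda>p. free_act p v) ` u)"

definition highest_vec :: "nat \<Rightarrow> (nat \<Rightarrow> nat) \<Rightarrow> vec"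
  where "highest_vec n lam =
    Poly_Mapping.single (map (\<lambda>j. [1..<Suc j]) (column_heights n lam)) 1"

definition V_Z :: "nat \<Rightarrow> (nat \<Rightarrow> nat) \<Rightarrow> vec set"
  where "V_Z n lam = (\<lambda>u. uq_act u (highest_vec n lam)) ` UminusZ n"

definition vec_has_weight :: "nat \<Rightarrow> (nat \<Rightarrow> int) \<Rightarrow> vec \<Rightarrow> bool"
  where "vec_has_weight n nu v \<longleftrightarrow>
    (\<forall>i\<in>{1..<n}. gen_act (GenK i) v = vscale (qq powi nu i) v)"

definition divF_vec :: "nat \<Rightarrow> nat \<Rightarrow> vec \<Rightarrow> vec"
  where "divF_vec i k v = vscale (1 / qfact k) ((gen_act (GenF i) ^^ k) v)"

definition kashiwara_mod :: "nat \<Rightarrow> (nat \<Rightarrow> nat) \<Rightarrow> nat \<Rightarrow> vec \<Rightarrow> vec"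
  where "kashiwara_mod n lam i v = (THE v'. \<exists>N vs.
    (\<forall>r\<le>N. vs r \<in> tensor_space n lam \<and> (\<exists>nu. vec_has_weight n nu (vs r)) \<and>
       gen_act (GenE i) (vs r) = 0) \<and>
    v = (\<Sum>r\<in>{..N}. divF_vec i r (vs r)) \<and>
    v' = (\<Sum>r\<in>{..N}. divF_vec i (Suc r) (vs r)))"

definition L_mod :: "nat \<Rightarrow> (nat \<Rightarrow> nat) \<Rightarrow> vec set"
  where "L_mod n lam = span_over 0 (+) vscale regular_ring
    {foldr (kashiwara_mod n lam) is (highest_vec n lam) | is. is \<in> lists {1..<n}}"

definition LZ_mod :: "nat \<Rightarrow> (nat \<Rightarrow> nat) \<Rightarrow> vec set"
  where "LZ_mod n lam = V_Z n lam \<inter> L_mod n lam"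

text \<open>The weight space of weight \<open>lam - mu\<close>.\<close>

definition vec_wt_space :: "nat \<Rightarrow> (nat \<Rightarrow> nat) \<Rightarrow> (nat \<Rightarrow> nat) \<Rightarrow> vec set"
  where "vec_wt_space n lam mu = {v. vec_has_weight n (\<lambda>i. int (lam i) - root_pairing n i mu) v}"


section \<open>Large weights and the dual bases\<close>

text \<open>
  Acting on the highest weight vector is linear, so bijectivity makes it an isomorphism of modules
  over the ring Z[q, 1/q].
\<close>

definition lattices_identified :: "nat \<Rightarrow> (nat \<Rightarrow> nat) \<Rightarrow> (nat \<Rightarrow> nat) \<Rightarrow> bool"
  where "lattices_identified n lam mu \<longleftrightarrow>
    bij_betw (\<lambda>u. uq_act u (highest_vec n lam))
      (UminusZ n \<inter> uq_wt_space n mu) (V_Z n lam \<inter> vec_wt_space n lam mu) \<and>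
    (\<lambda>u. uq_act u (highest_vec n lam)) ` (LZ_inf n \<inter> uq_wt_space n mu)
      = LZ_mod n lam \<inter> vec_wt_space n lam mu"

definition large_weight :: "nat \<Rightarrow> (nat \<Rightarrow> nat) \<Rightarrow> (nat \<Rightarrow> nat) \<Rightarrow> bool"
  where "large_weight n lam mu \<longleftrightarrow> lattices_identified n lam mu \<and>
    (\<forall>t\<in>std_tableaux n lam. has_tab_weight n mu t \<longrightarrow> special t)"

text \<open>The vector \<open>w\<close> is the member with index \<open>s\<close> of the basis dual to the standard tableaux.\<close>

definition is_dual_vec :: "nat \<Rightarrow> (nat \<Rightarrow> nat) \<Rightarrow> tableau \<Rightarrow> vec \<Rightarrow> bool"
  where "is_dual_vec n lam s w \<longleftrightarrow> w \<in> LZ_mod n lam \<and>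
    (\<forall>t\<in>std_tableaux n lam. Poly_Mapping.lookup w t = (if t = s then 1 else 0))"

text \<open>The same basis element, transported to the negative part of the quantum group.\<close>

definition dual_elt :: "nat \<Rightarrow> (nat \<Rightarrow> nat) \<Rightarrow> (nat \<Rightarrow> nat) \<Rightarrow> tableau \<Rightarrow> uq"
  where "dual_elt n lam mu s = (THE u. u \<in> LZ_inf n \<inter> uq_wt_space n mu \<and>
    is_dual_vec n lam s (uq_act u (highest_vec n lam)))"

end

(*
The comparison is made for arbitrary elements u of weight - mu: the coefficient of u v_lam at a
special standard tableau does not change when a column 1, ..., j of highest weight is deleted both
from the tableau and from the shape. Indeed such a column can only contribute a factor q, through
K_j, when some F_j acts to its right; the columns to its right which contain j + 1 but arise from
one containing j have height at most j, hence equal j, and in a standard tableau those are again of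
highest weight. So the coefficient only depends on the remaining columns, which are determined by
the numbers a_k^r.

For the correspondence of tableaux it remains to see that the remaining columns fit into the shape
of every large weight. Injectivity of the identification forces lam_k >= mu_k for all k, because
F_k^(mu_k) kills the highest weight vector otherwise, while no monomial in the F_i vanishes in the
quantum group: it acts on a suitable tensor product of one-box columns with non-negative
coefficients, not all zero, for the ordering of Q(q) in which q is infinitely large.

The crystal lattices enter only through the hypothesis that they correspond to each other.
*)

theory Submission
  imports Defs
begin

text \<open>A coset acts by the common value of its members, so coefficients of u v_lam become
  accessible only after all defining relations have been verified on tensor products. Coefficients
  are then followed backwards, from the target tableau: undoing an F replaces some c + 1 by c in one
  column. Standardness does not survive this; the weaker condition \<open>follows\<close> does and
  serves as the invariant. A dual vector is also tested on standard tableaux of weights other than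
  mu, about which largeness says nothing. There the coefficient vanishes, but to see this the weight
  counted by the a_k^r must be recovered from the eigenvalues of the K_i, which amounts to the
  nondegeneracy of the Cartan matrix.\<close>

abbreviation coef :: "('a \<Rightarrow>\<^sub>0 'b::zero) \<Rightarrow> 'a \<Rightarrow> 'b"
  where "coef \<equiv> Poly_Mapping.lookup"

abbreviation basis_vec :: "tableau \<Rightarrow> vec"
  where "basis_vec t \<equiv> Poly_Mapping.single t 1"

section \<open>Linear maps on formal combinations of tableaux\<close>

lemma coef_vscale [simp]: "coef (vscale c v) t = c * coef v t"
  by (simp add: vscale_def Poly_Mapping.map.rep_eq when_def)

lemma vscale_zero [simp]: "vscale 0 v = 0" "vscale c 0 = 0"
  by (rule poly_mapping_eqI; simp)+

lemma vscale_one [simp]: "vscale 1 v = v"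
  by (rule poly_mapping_eqI) simp

lemma vscale_vscale [simp]: "vscale a (vscale b v) = vscale (a * b) v"
  by (rule poly_mapping_eqI) simp

lemma vscale_add: "vscale c (v + w) = vscale c v + vscale c w"
  by (rule poly_mapping_eqI) (simp add: lookup_add distrib_left)

lemma vscale_minus: "vscale c (v - w) = vscale c v - vscale c w"
  by (rule poly_mapping_eqI) (simp add: lookup_minus right_diff_distrib)

lemma vscale_add_left: "vscale (a + b) v = vscale a v + vscale b v"
  by (rule poly_mapping_eqI) (simp add: lookup_add distrib_right)

lemma vscale_sum: "vscale c (sum f A) = (\<Sum>x\<in>A. vscale c (f x))"
  by (induction A rule: infinite_finite_induct) (simp_all add: vscale_add)

lemma vscale_single [simp]: "vscale c (Poly_Mapping.single t a) = Poly_Mapping.single t (c * a)"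
  by (rule poly_mapping_eqI) (simp add: lookup_single when_def)

lemma keys_vscale: "Poly_Mapping.keys (vscale c v) \<subseteq> Poly_Mapping.keys v"
  by (auto simp: in_keys_iff)

text \<open>Unlike in \<open>update_induct\<close>, the new key may already occur. Additive
  statements lose nothing by this and need no side conditions on supports.\<close>

lemma poly_mapping_add_induct [case_names zero add]:
  fixes p :: "'a \<Rightarrow>\<^sub>0 'b::ab_group_add"
  assumes "P 0" and "\<And>p t c. P p \<Longrightarrow> P (Poly_Mapping.single t c + p)"
  shows "P p"
proof (induction p rule: update_induct)
  case const
  show ?case by (rule assms(1))
next
  case (update f a b)
  have "Poly_Mapping.update a b f = Poly_Mapping.single a b + f"
    using update(1)
    by (intro poly_mapping_eqI)
      (auto simp: lookup_update lookup_add lookup_single in_keys_iff when_def)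
  with update(3) assms(2) show ?case by simp
qed

definition linear_map :: "(vec \<Rightarrow> vec) \<Rightarrow> bool"
  where "linear_map f \<longleftrightarrow> (\<forall>v w. f (v + w) = f v + f w) \<and> (\<forall>c v. f (vscale c v) = vscale c (f v))"

lemma linear_mapD:
  assumes "linear_map f"
  shows "f (v + w) = f v + f w" "f (vscale c v) = vscale c (f v)"
    "f 0 = 0" "f (- v) = - f v" "f (v - w) = f v - f w"
proof -
  show add: "f (v + w) = f v + f w" for v w using assms by (simp add: linear_map_def)
  show "f (vscale c v) = vscale c (f v)" using assms by (simp add: linear_map_def)
  show zero: "f 0 = 0" using add[of 0 0] by simp
  show minus: "f (- v) = - f v" for v
    using add[of v "- v"] zero by (simp add: eq_neg_iff_add_eq_0 add.commute)
  show "f (v - w) = f v - f w" using add[of v "- w"] minus[of w] by simp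
qed

lemma linear_map_intros:
  "linear_map (\<lambda>v. v)"
  "linear_map (\<lambda>v. 0)"
  "linear_map f \<Longrightarrow> linear_map (\<lambda>v. vscale c (f v))"
  "linear_map f \<Longrightarrow> linear_map g \<Longrightarrow> linear_map (\<lambda>v. f v + g v)"
  "linear_map f \<Longrightarrow> linear_map g \<Longrightarrow> linear_map (\<lambda>v. f v - g v)"
  "linear_map f \<Longrightarrow> linear_map g \<Longrightarrow> linear_map (\<lambda>v. if P then f v else g v)"
  by (simp_all add: linear_map_def vscale_add vscale_minus mult.commute)

lemma linear_map_compose: "linear_map h \<Longrightarrow> linear_map f \<Longrightarrow> linear_map (\<lambda>v. h (f v))"
  by (simp add: linear_map_def)

text \<open>The quantifier stays in the object logic so that \<open>f\<close> and \<open>g\<close>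
  are applied to a bound variable and are found by pattern unification; \<open>rule_format\<close>
  removes it in the instances.\<close>

lemma linear_map_ext:
  assumes "linear_map f" "linear_map g" and "\<And>t. f (basis_vec t) = g (basis_vec t)"
  shows "\<forall>v. f v = g v"
proof
  show "f v = g v" for v
  proof (induction v rule: poly_mapping_add_induct)
    case zero
    then show ?case using assms by (simp add: linear_mapD)
  next
    case (add p t c)
    have "Poly_Mapping.single t c = vscale c (basis_vec t)" by simp
    then show ?case using assms add by (simp only: linear_mapD)
  qed
qed

lemma lin_ext_superset:
  assumes "finite S" and "Poly_Mapping.keys v \<subseteq> S"
  shows "lin_ext f v = (\<Sum>x\<in>S. vscale (coef v x) (f x))"
  unfolding lin_ext_def using assms
  by (intro sum.mono_neutral_left) (auto simp: in_keys_iff)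

lemma linear_map_lin_ext [simp]: "linear_map (lin_ext f)"
  unfolding linear_map_def
proof (intro conjI allI)
  fix v w :: vec and c
  let ?S = "Poly_Mapping.keys v \<union> Poly_Mapping.keys w"
  show "lin_ext f (v + w) = lin_ext f v + lin_ext f w"
    using keys_add[of v w]
    by (simp add: lin_ext_superset[of ?S] lookup_add vscale_add_left sum.distrib)
  show "lin_ext f (vscale c v) = vscale c (lin_ext f v)"
    using keys_vscale[of c v]
    by (simp add: lin_ext_superset[of "Poly_Mapping.keys v"] vscale_sum)
qed

lemma lin_ext_single [simp]: "lin_ext f (Poly_Mapping.single t c) = vscale c (f t)"
  by (simp add: lin_ext_def)

lemma linear_map_gen_act [simp]: "linear_map (gen_act g)"
  by (cases g) simp_all

lemma linear_map_tensor_col [simp]: "linear_map (tensor_col x)"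
  by (simp add: tensor_col_def)

lemmas linear_intros = linear_map_intros
  linear_map_compose[OF linear_map_tensor_col] linear_map_compose[OF linear_map_gen_act]

lemmas tensor_col_linear = linear_mapD[OF linear_map_tensor_col]
lemmas gen_act_linear = linear_mapD[OF linear_map_gen_act]
declare gen_act_linear(3) [simp]

lemma tensor_col_single [simp]: "tensor_col x (Poly_Mapping.single t c) = Poly_Mapping.single (x # t) c"
  by (simp add: tensor_col_def)

lemma gen_act_single [simp]:
  "gen_act (GenF c) (Poly_Mapping.single t a) = vscale a (F_tab c t)"
  "gen_act (GenE c) (Poly_Mapping.single t a) = vscale a (E_tab c t)"
  "gen_act (GenK c) (Poly_Mapping.single t a) = Poly_Mapping.single t (a * K_tab c t)"
  "gen_act (GenKinv c) (Poly_Mapping.single t a) = Poly_Mapping.single t (a * inverse (K_tab c t))"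
  by simp_all

declare gen_act.simps [simp del]

definition word_act :: "gen list \<Rightarrow> vec \<Rightarrow> vec"
  where "word_act w v = foldr gen_act w v"

lemma word_act_simps [simp]:
  "word_act [] v = v" "word_act (g # w) v = gen_act g (word_act w v)"
  "word_act (w @ w') v = word_act w (word_act w' v)"
  by (simp_all add: word_act_def)

lemma linear_map_word_act [simp]: "linear_map (word_act w)"
  by (induction w) (simp_all add: linear_map_def word_act_def gen_act_linear)

lemmas word_act_linear = linear_mapD[OF linear_map_word_act]

section \<open>The action of the free algebra\<close>

lemma free_act_superset:
  assumes "finite S" and "Poly_Mapping.keys p \<subseteq> S"
  shows "free_act p v = (\<Sum>w\<in>S. vscale (coef p w) (word_act (letters w) v))"
  unfolding free_act_def word_act_def using assms
  by (intro sum.mono_neutral_left) (auto simp: in_keys_iff)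

lemma free_act_add: "free_act (p + p') v = free_act p v + free_act p' v"
  using keys_add[of p p']
  by (simp add: free_act_superset[of "Poly_Mapping.keys p \<union> Poly_Mapping.keys p'"]
      lookup_add vscale_add_left sum.distrib)

lemma free_act_zero [simp]: "free_act 0 v = 0"
  by (simp add: free_act_def)

lemma free_act_uminus: "free_act (- p) v = - free_act p v"
  using free_act_add[of p "- p" v] by (simp add: eq_neg_iff_add_eq_0 add.commute)

lemma free_act_minus: "free_act (p - p') v = free_act p v - free_act p' v"
  using free_act_add[of p "- p'" v] by (simp add: free_act_uminus)

lemma free_act_single: "free_act (Poly_Mapping.single w c) v = vscale c (word_act (letters w) v)"
  by (simp add: free_act_def word_act_def)

lemma linear_map_free_act [simp]: "linear_map (free_act p)"
  by (induction p rule: poly_mapping_add_induct)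
    (simp_all add: linear_map_def free_act_add free_act_single vscale_add word_act_linear mult.commute)

lemmas free_act_linear = linear_mapD[OF linear_map_free_act]

lemma free_act_mult: "free_act (p * p') v = free_act p (free_act p' v)"
proof (induction p rule: poly_mapping_add_induct)
  case (add p w c)
  have "free_act (Poly_Mapping.single w c * p') v = free_act (Poly_Mapping.single w c) (free_act p' v)"
    by (induction p' rule: poly_mapping_add_induct)
      (simp_all add: distrib_left mult_single free_act_add free_act_single plus_word_def
        word_act_linear vscale_add)
  with add show ?case by (simp add: distrib_right free_act_add)
qed simp

lemma free_act_var [simp]: "free_act (var g) v = gen_act g v"
  by (simp add: var_def free_act_single)

lemma free_act_scl [simp]: "free_act (scl c) v = vscale c v"
  by (simp add: scl_def free_act_single zero_word_def)

lemma free_act_one [simp]: "free_act 1 v = v"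
  using free_act_scl[of 1 v] by (simp add: scl_def)

section \<open>The defining relations hold on tensor products\<close>

text \<open>Polynomials are ordered by the sign of the leading coefficient. The order serves twice:
  it gives q \<noteq> 1/q at once, and it makes the matrix coefficients of the F between basis
  vectors nonnegative, so that they cannot cancel.\<close>

lemma qq_gt_1: "1 < qq"
proof -
  have "[:0, 1:] - 1 = [:- 1, 1 :: rat:]" by (simp add: one_pCons)
  then have "1 < [:0, 1 :: rat:]" by (simp add: less_poly_def pos_poly_pCons)
  then show ?thesis by (simp add: qq_def One_fract_def)
qed

lemma qq_pos [simp]: "0 < qq" and qq_nonzero [simp]: "qq \<noteq> 0"
  using qq_gt_1 by auto

lemma qq_minus_inverse_nonzero [simp]: "qq - inverse qq \<noteq> 0"
proof -
  have "inverse qq < 1" using qq_gt_1 by (simp add: inverse_less_1_iff)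
  then have "inverse qq < qq" using qq_gt_1 by (rule less_trans)
  then show ?thesis by (metis less_irrefl right_minus_eq)
qed

lemma qint_1 [simp]: "qint (Suc 0) = 1"
  using qq_minus_inverse_nonzero by (simp add: qint_def del: qq_minus_inverse_nonzero)

lemma qint_2: "qint 2 = qq + inverse qq"
proof -
  have "qq ^ 2 - inverse qq ^ 2 = (qq + inverse qq) * (qq - inverse qq)"
    by (simp add: power2_eq_square algebra_simps)
  then show ?thesis using qq_minus_inverse_nonzero
    by (simp add: qint_def nonzero_mult_div_cancel_right del: qq_minus_inverse_nonzero)
qed

section \<open>Single columns: replacing an entry, and the eigenvalues of K\<close>

lemma mem_col_replace:
  "a \<noteq> b \<Longrightarrow> m \<in> set (col_replace a b x) \<longleftrightarrow> (m = b \<and> a \<in> set x) \<or> (m \<noteq> a \<and> m \<in> set x)"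
  by (auto simp: col_replace_def image_iff)

lemma col_replace_inverse: "b \<notin> set x \<Longrightarrow> col_replace b a (col_replace a b x) = x"
  by (auto simp: col_replace_def intro!: map_idI)

lemma col_replace_commute:
  "a \<noteq> c \<Longrightarrow> a \<noteq> d \<Longrightarrow> b \<noteq> c \<Longrightarrow> col_replace a b (col_replace c d x) = col_replace c d (col_replace a b x)"
  by (auto simp: col_replace_def)

lemma K_col_nonzero [simp]: "K_col c x \<noteq> 0"
  by (simp add: K_col_def)

text \<open>Replacing j by j + 1 subtracts alpha_j from the weight of the column. Only membership of
  entries enters, so this and the relations below hold for arbitrary lists as columns, as identities
  on all of \<open>vec\<close> require.\<close>

lemma K_col_raise:
  "j \<in> set x \<Longrightarrow> Suc j \<notin> set x \<Longrightarrow>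
    K_col i (col_replace j (Suc j) x) = qq powi (- cartan i j) * K_col i x"
  by (auto simp: K_col_def cartan_def mem_col_replace power_int_minus power2_eq_square)

lemma K_col_lower:
  "Suc j \<in> set x \<Longrightarrow> j \<notin> set x \<Longrightarrow>
    K_col i (col_replace (Suc j) j x) = qq powi cartan i j * K_col i x"
  by (auto simp: K_col_def cartan_def mem_col_replace power_int_minus power2_eq_square)

lemma K_tab_Cons [simp]: "K_tab c [] = 1" "K_tab c (x # t) = K_col c x * K_tab c t"
  by (simp_all add: K_tab_def)

lemma K_tab_nonzero [simp]: "K_tab c t \<noteq> 0"
  by (induction t) simp_all

text \<open>The recursion for \<open>F_tab\<close>, extended from basis vectors to any second tensor
  factor. In this form the comultiplication can be applied several times in a row.\<close>

lemma F_tensor [rule_format]: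
  "\<forall>v. gen_act (GenF c) (tensor_col x v) =
    (if c \<in> set x \<and> Suc c \<notin> set x then tensor_col (col_replace c (Suc c) x) v else 0)
    + vscale (K_col c x) (tensor_col x (gen_act (GenF c) v))"
  by (rule linear_map_ext; (intro linear_intros)?; simp)

lemma E_tensor [rule_format]:
  "\<forall>v. gen_act (GenE c) (tensor_col x v) =
    (if Suc c \<in> set x \<and> c \<notin> set x
     then tensor_col (col_replace (Suc c) c x) (gen_act (GenKinv c) v) else 0)
    + tensor_col x (gen_act (GenE c) v)"
  by (rule linear_map_ext; (intro linear_intros)?; simp)

lemma K_tensor [rule_format]:
  "\<forall>v. gen_act (GenK c) (tensor_col x v) = vscale (K_col c x) (tensor_col x (gen_act (GenK c) v))"
  by (rule linear_map_ext; (intro linear_intros)?; simp)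

lemma Kinv_tensor [rule_format]:
  "\<forall>v. gen_act (GenKinv c) (tensor_col x v) =
    vscale (inverse (K_col c x)) (tensor_col x (gen_act (GenKinv c) v))"
  by (rule linear_map_ext; (intro linear_intros)?; simp)

lemmas gen_tensor = F_tensor E_tensor K_tensor Kinv_tensor

text \<open>Induction on the number of tensor factors. Each relation is compatible with the
  comultiplication, so it remains to add one column, of which only a few entries matter.\<close>

lemma linear_eq_by_columns:
  assumes "linear_map f" "linear_map g" and "f (basis_vec []) = g (basis_vec [])"
    and "\<And>x v. f v = g v \<Longrightarrow> f (tensor_col x v) = g (tensor_col x v)"
  shows "\<forall>v. f v = g v"
proof (rule linear_map_ext[OF assms(1,2)])
  show "f (basis_vec t) = g (basis_vec t)" for t
  proof (induction t)
    case (Cons x t)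
    from assms(4)[OF this] show ?case by simp
  qed (rule assms(3))
qed

lemmas linear_simps = gen_act_linear tensor_col_linear vscale_add vscale_minus
  mult.commute mult.left_commute

section \<open>The relations between the generators\<close>

lemma K_Kinv [rule_format, simp]: "\<forall>v. gen_act (GenK i) (gen_act (GenKinv i) v) = v"
  by (rule linear_map_ext; (intro linear_intros)?; simp)

lemma Kinv_K [rule_format, simp]: "\<forall>v. gen_act (GenKinv i) (gen_act (GenK i) v) = v"
  by (rule linear_map_ext; (intro linear_intros)?; simp)

lemma K_K [rule_format]:
  "\<forall>v. gen_act (GenK i) (gen_act (GenK j) v) = gen_act (GenK j) (gen_act (GenK i) v)"
  by (rule linear_map_ext; (intro linear_intros)?; simp add: mult.commute)

lemma Kinv_Kinv [rule_format]:
  "\<forall>v. gen_act (GenKinv i) (gen_act (GenKinv j) v) = gen_act (GenKinv j) (gen_act (GenKinv i) v)"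
  by (rule linear_map_ext; (intro linear_intros)?; simp add: mult.commute)

lemma K_F_Kinv [rule_format]:
  "\<forall>v. gen_act (GenK i) (gen_act (GenF j) (gen_act (GenKinv i) v)) =
    vscale (qq powi (- cartan i j)) (gen_act (GenF j) v)"
proof (rule linear_eq_by_columns)
  fix x v
  assume IH: "gen_act (GenK i) (gen_act (GenF j) (gen_act (GenKinv i) v)) =
    vscale (qq powi (- cartan i j)) (gen_act (GenF j) v)"
  show "gen_act (GenK i) (gen_act (GenF j) (gen_act (GenKinv i) (tensor_col x v))) =
    vscale (qq powi (- cartan i j)) (gen_act (GenF j) (tensor_col x v))"
    by (rule poly_mapping_eqI)
      (simp add: gen_tensor K_col_raise linear_simps IH lookup_add field_simps)
qed ((intro linear_intros)?; simp)+

lemma K_E_Kinv [rule_format]: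
  "\<forall>v. gen_act (GenK i) (gen_act (GenE j) (gen_act (GenKinv i) v)) =
    vscale (qq powi cartan i j) (gen_act (GenE j) v)"
proof (rule linear_eq_by_columns)
  fix x v
  assume IH: "gen_act (GenK i) (gen_act (GenE j) (gen_act (GenKinv i) v)) =
    vscale (qq powi cartan i j) (gen_act (GenE j) v)"
  show "gen_act (GenK i) (gen_act (GenE j) (gen_act (GenKinv i) (tensor_col x v))) =
    vscale (qq powi cartan i j) (gen_act (GenE j) (tensor_col x v))"
    by (rule poly_mapping_eqI)
      (simp add: gen_tensor K_col_lower linear_simps IH lookup_add field_simps Kinv_Kinv[of j i])
qed ((intro linear_intros)?; simp)+

text \<open>The comultiplication of E puts \<open>GenKinv\<close> on the right tensor factor, where
  it meets F; this rule brings the two into a fixed order.\<close>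

lemma Kinv_F:
  "gen_act (GenKinv i) (gen_act (GenF j) v) =
    vscale (qq powi cartan i j) (gen_act (GenF j) (gen_act (GenKinv i) v))"
proof -
  have "gen_act (GenF j) (gen_act (GenKinv i) v) =
      vscale (qq powi (- cartan i j)) (gen_act (GenKinv i) (gen_act (GenF j) v))"
    using arg_cong[OF K_F_Kinv[of i j v], of "gen_act (GenKinv i)"]
    by (simp add: gen_act_linear)
  then show ?thesis by (simp flip: power_int_add)
qed

lemma Kinv_E:
  "gen_act (GenKinv i) (gen_act (GenE j) v) =
    vscale (qq powi (- cartan i j)) (gen_act (GenE j) (gen_act (GenKinv i) v))"
proof -
  have "gen_act (GenE j) (gen_act (GenKinv i) v) =
      vscale (qq powi cartan i j) (gen_act (GenKinv i) (gen_act (GenE j) v))"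
    using arg_cong[OF K_E_Kinv[of i j v], of "gen_act (GenKinv i)"]
    by (simp add: gen_act_linear)
  then show ?thesis by (simp flip: power_int_add)
qed

text \<open>If both act on the new column, the replacements commute for distant indices, and for
  adjacent ones both products vanish on it. If F acts to the right of E, one order takes a power of
  q from \<open>Kinv_F\<close> and the other takes it from \<open>K_col_lower\<close>; these agree
  since the Cartan matrix is symmetric.\<close>

lemma E_F_diff [rule_format]:
  assumes "i \<noteq> j"
  shows "\<forall>v. gen_act (GenE i) (gen_act (GenF j) v) = gen_act (GenF j) (gen_act (GenE i) v)"
proof (rule linear_eq_by_columns)
  fix x v
  assume IH: "gen_act (GenE i) (gen_act (GenF j) v) = gen_act (GenF j) (gen_act (GenE i) v)"
  have "qq powi cartan i j = qq powi cartan j i" by (simp add: cartan_def)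
  moreover have "col_replace (Suc i) i (col_replace j (Suc j) x) =
      col_replace j (Suc j) (col_replace (Suc i) i x)"
    if "i \<noteq> Suc j" "j \<noteq> Suc i" using that assms by (intro col_replace_commute) auto
  ultimately
  show "gen_act (GenE i) (gen_act (GenF j) (tensor_col x v)) =
    gen_act (GenF j) (gen_act (GenE i) (tensor_col x v))"
    using assms
    by (auto simp: gen_tensor K_col_lower linear_simps IH Kinv_F mem_col_replace)
qed ((intro linear_intros)?; simp)+

text \<open>Let d = 1/(q - 1/q). If the new column contains i but not i + 1, then d (q K - q^-1
  K^-1) is required on the other factors and induction supplies q d (K - K^-1). The difference K^-1
  comes from E returning a column that F has just raised. With i + 1 but not i the difference is -
  K^-1 and comes from F after E.\<close>

lemma E_F_same [rule_format]:
  "\<forall>v. gen_act (GenE i) (gen_act (GenF i) v) = gen_act (GenF i) (gen_act (GenE i) v)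
    + vscale (1 / (qq - inverse qq)) (gen_act (GenK i) v - gen_act (GenKinv i) v)"
proof (rule linear_eq_by_columns)
  fix x v
  define d where "d = 1 / (qq - inverse qq)"
  assume "gen_act (GenE i) (gen_act (GenF i) v) = gen_act (GenF i) (gen_act (GenE i) v) +
    vscale (1 / (qq - inverse qq)) (gen_act (GenK i) v - gen_act (GenKinv i) v)"
  note IH = this[folded d_def]
  \<comment> \<open>All that is used about d: (q - 1/q) d = 1. The variant d' carries a further
    factor so that it also rewrites inside longer products.\<close>
  have d: "d * qq = 1 + d * inverse qq"
    using qq_minus_inverse_nonzero unfolding d_def
    by (simp add: divide_simps del: qq_minus_inverse_nonzero)
  have d': "qq * (d * c) = c + d * (c * inverse qq)" for c
    using arg_cong[OF d, of "\<lambda>z. z * c"] by (simp add: algebra_simps)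
  have "gen_act (GenE i) (gen_act (GenF i) (tensor_col x v)) =
    gen_act (GenF i) (gen_act (GenE i) (tensor_col x v))
    + vscale d (gen_act (GenK i) (tensor_col x v) - gen_act (GenKinv i) (tensor_col x v))"
  proof (cases "i \<in> set x \<longleftrightarrow> Suc i \<in> set x")
    case True
    then have "K_col i x = 1" by (auto simp: K_col_def)
    with True show ?thesis
      by (simp add: gen_tensor gen_act_linear tensor_col_linear vscale_minus IH)
  next
    case False
    show ?thesis
    proof (cases "i \<in> set x")
      case True
      with False have x: "i \<in> set x" "Suc i \<notin> set x" "K_col i x = qq" by (auto simp: K_col_def)
      show ?thesis
        by (rule poly_mapping_eqI)
          (simp add: x gen_tensor gen_act_linear tensor_col_linear IH mem_col_replace
            col_replace_inverse lookup_add lookup_minus algebra_simps d')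
    next
      case F: False
      with False have x: "i \<notin> set x" "Suc i \<in> set x" "K_col i x = inverse qq"
        by (auto simp: K_col_def)
      have "K_col i (col_replace (Suc i) i x) = qq"
        using x by (simp add: K_col_def mem_col_replace)
      then show ?thesis
        by (intro poly_mapping_eqI)
          (simp add: x gen_tensor gen_act_linear tensor_col_linear IH mem_col_replace Kinv_F cartan_def
            power2_eq_square col_replace_inverse lookup_add lookup_minus algebra_simps d')
    qed
  qed
  then show "gen_act (GenE i) (gen_act (GenF i) (tensor_col x v)) =
    gen_act (GenF i) (gen_act (GenE i) (tensor_col x v))
    + vscale (1 / (qq - inverse qq)) (gen_act (GenK i) (tensor_col x v) - gen_act (GenKinv i) (tensor_col x v))"
    by (simp add: d_def)
qed ((intro linear_intros)?; simp)+

lemma K_col_adjacent: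
  "Suc i \<in> set x \<Longrightarrow> i \<in> set x \<Longrightarrow> K_col i x = 1"
  "Suc i \<in> set x \<Longrightarrow> i \<notin> set x \<Longrightarrow> K_col i x = inverse qq"
  "Suc i \<notin> set x \<Longrightarrow> i \<in> set x \<Longrightarrow> K_col i x = qq"
  "Suc i \<notin> set x \<Longrightarrow> i \<notin> set x \<Longrightarrow> K_col i x = 1"
  by (simp_all add: K_col_def)

lemma F_commute [rule_format]:
  assumes "i \<noteq> Suc j" "j \<noteq> Suc i"
  shows "\<forall>v. gen_act (GenF i) (gen_act (GenF j) v) = gen_act (GenF j) (gen_act (GenF i) v)"
proof (cases "i = j")
  case False
  show ?thesis
  proof (rule linear_eq_by_columns)
    fix x v
    assume IH: "gen_act (GenF i) (gen_act (GenF j) v) = gen_act (GenF j) (gen_act (GenF i) v)"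
    have "col_replace i (Suc i) (col_replace j (Suc j) x) = col_replace j (Suc j) (col_replace i (Suc i) x)"
      using assms False by (intro col_replace_commute) auto
    then show "gen_act (GenF i) (gen_act (GenF j) (tensor_col x v)) =
        gen_act (GenF j) (gen_act (GenF i) (tensor_col x v))"
      using assms False
      by (auto simp: gen_tensor K_col_raise linear_simps IH mem_col_replace cartan_def add_ac)
  qed ((intro linear_intros)?; simp)+
qed simp

lemma E_commute [rule_format]:
  assumes "i \<noteq> Suc j" "j \<noteq> Suc i"
  shows "\<forall>v. gen_act (GenE i) (gen_act (GenE j) v) = gen_act (GenE j) (gen_act (GenE i) v)"
proof (cases "i = j")
  case False
  show ?thesis
  proof (rule linear_eq_by_columns)
    fix x v
    assume IH: "gen_act (GenE i) (gen_act (GenE j) v) = gen_act (GenE j) (gen_act (GenE i) v)"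
    have "col_replace (Suc i) i (col_replace (Suc j) j x) = col_replace (Suc j) j (col_replace (Suc i) i x)"
      using assms False by (intro col_replace_commute) auto
    then show "gen_act (GenE i) (gen_act (GenE j) (tensor_col x v)) =
        gen_act (GenE j) (gen_act (GenE i) (tensor_col x v))"
      using assms False
      by (auto simp: gen_tensor Kinv_E Kinv_Kinv[of i j] linear_simps IH mem_col_replace cartan_def add_ac)
  qed ((intro linear_intros)?; simp)+
qed simp

text \<open>Solved for the product beginning with F_i F_i, so that the induction hypothesis
  rewrites. Only three consecutive entries of a column matter, which makes eight cases, each a
  Laurent polynomial identity with [2] = q + 1/q.\<close>

lemma F_serre [rule_format]:
  assumes "j = Suc i \<or> i = Suc j"
  shows "\<forall>v. gen_act (GenF i) (gen_act (GenF i) (gen_act (GenF j) v)) =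
    vscale (qint 2) (gen_act (GenF i) (gen_act (GenF j) (gen_act (GenF i) v)))
    - gen_act (GenF j) (gen_act (GenF i) (gen_act (GenF i) v))"
proof (rule linear_eq_by_columns)
  fix x v
  assume IH: "gen_act (GenF i) (gen_act (GenF i) (gen_act (GenF j) v)) =
    vscale (qint 2) (gen_act (GenF i) (gen_act (GenF j) (gen_act (GenF i) v)))
    - gen_act (GenF j) (gen_act (GenF i) (gen_act (GenF i) v))"
  from assms have "j = Suc i \<and> i \<noteq> Suc (Suc i) \<or> i = Suc j \<and> j \<noteq> Suc (Suc j)" by simp
  then show "gen_act (GenF i) (gen_act (GenF i) (gen_act (GenF j) (tensor_col x v))) =
    vscale (qint 2) (gen_act (GenF i) (gen_act (GenF j) (gen_act (GenF i) (tensor_col x v))))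
    - gen_act (GenF j) (gen_act (GenF i) (gen_act (GenF i) (tensor_col x v)))"
  proof (elim disjE conjE)
    assume j: "j = Suc i"
    show ?thesis
      by (cases "i \<in> set x"; cases "Suc i \<in> set x"; cases "Suc (Suc i) \<in> set x";
          intro poly_mapping_eqI;
          simp add: j gen_tensor K_col_adjacent mem_col_replace gen_act_linear tensor_col_linear
            vscale_add vscale_minus IH[unfolded j] qint_2 lookup_add lookup_minus;
          simp add: field_simps)
  next
    assume i: "i = Suc j"
    show ?thesis
      by (cases "j \<in> set x"; cases "Suc j \<in> set x"; cases "Suc (Suc j) \<in> set x";
          intro poly_mapping_eqI;
          simp add: i gen_tensor K_col_adjacent mem_col_replace gen_act_linear tensor_col_linear
            vscale_add vscale_minus IH[unfolded i] qint_2 lookup_add lookup_minus;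
          simp add: field_simps)
  qed
qed ((intro linear_intros)?; simp)+

lemma E_serre [rule_format]:
  assumes "j = Suc i \<or> i = Suc j"
  shows "\<forall>v. gen_act (GenE i) (gen_act (GenE i) (gen_act (GenE j) v)) =
    vscale (qint 2) (gen_act (GenE i) (gen_act (GenE j) (gen_act (GenE i) v)))
    - gen_act (GenE j) (gen_act (GenE i) (gen_act (GenE i) v))"
proof (rule linear_eq_by_columns)
  fix x v
  assume IH: "gen_act (GenE i) (gen_act (GenE i) (gen_act (GenE j) v)) =
    vscale (qint 2) (gen_act (GenE i) (gen_act (GenE j) (gen_act (GenE i) v)))
    - gen_act (GenE j) (gen_act (GenE i) (gen_act (GenE i) v))"
  from assms have "j = Suc i \<and> i \<noteq> Suc (Suc i) \<or> i = Suc j \<and> j \<noteq> Suc (Suc j)" by simp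
  then show "gen_act (GenE i) (gen_act (GenE i) (gen_act (GenE j) (tensor_col x v))) =
    vscale (qint 2) (gen_act (GenE i) (gen_act (GenE j) (gen_act (GenE i) (tensor_col x v))))
    - gen_act (GenE j) (gen_act (GenE i) (gen_act (GenE i) (tensor_col x v)))"
  proof (elim disjE conjE)
    assume j: "j = Suc i"
    show ?thesis
      by (cases "i \<in> set x"; cases "Suc i \<in> set x"; cases "Suc (Suc i) \<in> set x";
          intro poly_mapping_eqI;
          simp add: j gen_tensor K_col_adjacent mem_col_replace gen_act_linear tensor_col_linear
            Kinv_E cartan_def power_int_minus power2_eq_square Kinv_Kinv[of i "Suc i"]
            vscale_add vscale_minus IH[unfolded j] qint_2 lookup_add lookup_minus;
          simp add: field_simps)
  next
    assume i: "i = Suc j"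
    show ?thesis
      by (cases "j \<in> set x"; cases "Suc j \<in> set x"; cases "Suc (Suc j) \<in> set x";
          intro poly_mapping_eqI;
          simp add: i gen_tensor K_col_adjacent mem_col_replace gen_act_linear tensor_col_linear
            Kinv_E cartan_def power_int_minus power2_eq_square Kinv_Kinv[of j "Suc j"]
            vscale_add vscale_minus IH[unfolded i] qint_2 lookup_add lookup_minus;
          simp add: field_simps)
  qed
qed ((intro linear_intros)?; simp)+

lemma relator_acts_zero:
  assumes "r \<in> uq_relators n"
  shows "free_act r v = 0"
proof -
  have [simp]: "free_act (if P then p else q) v = (if P then free_act p v else free_act q v)" for P p q
    by simp
  have serre: "free_act (serre GenF i j) v = 0" "free_act (serre GenE i j) v = 0" if "i \<noteq> j" for i j
    using that F_commute[of i j v] F_serre[of j i v] E_commute[of i j v] E_serre[of j i v]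
    by (auto simp: serre_def cartan_def free_act_add free_act_minus free_act_mult split: if_splits)
  show ?thesis
    using assms serre unfolding uq_relators_def
    by (auto simp: free_act_add free_act_minus free_act_mult K_K K_F_Kinv K_E_Kinv E_F_diff E_F_same)
      metis+
qed

section \<open>The quantum group acts\<close>

lemma free_carrier_add:
  "p \<in> carrier (free_ring n) \<Longrightarrow> p' \<in> carrier (free_ring n) \<Longrightarrow> p + p' \<in> carrier (free_ring n)"
  using keys_add[of p p'] by (auto simp: free_ring_def)

lemma free_carrier_uminus: "p \<in> carrier (free_ring n) \<Longrightarrow> - p \<in> carrier (free_ring n)"
  by (auto simp: free_ring_def in_keys_iff)

lemma free_carrier_minus:
  "p \<in> carrier (free_ring n) \<Longrightarrow> p' \<in> carrier (free_ring n) \<Longrightarrow> p - p' \<in> carrier (free_ring n)"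
  using free_carrier_add[of p n "- p'"] free_carrier_uminus[of p' n] by simp

lemma free_carrier_mult:
  "p \<in> carrier (free_ring n) \<Longrightarrow> p' \<in> carrier (free_ring n) \<Longrightarrow> p * p' \<in> carrier (free_ring n)"
  using keys_mult[of p p'] by (fastforce simp: free_ring_def plus_word_def)

lemma free_carrier_scl: "scl c \<in> carrier (free_ring n)"
  by (auto simp: free_ring_def scl_def zero_word_def)

lemma free_carrier_one: "1 \<in> carrier (free_ring n)"
  using free_carrier_scl[of 1 n] by (simp add: scl_def)

lemma free_carrier_zero: "0 \<in> carrier (free_ring n)"
  by (simp add: free_ring_def)

lemma free_carrier_var: "gen_index g \<in> {1..<n} \<Longrightarrow> var g \<in> carrier (free_ring n)"
  by (auto simp: free_ring_def var_def)

lemmas free_carrier_intros [simp] = free_carrier_add free_carrier_uminus free_carrier_minus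
  free_carrier_mult free_carrier_scl free_carrier_one free_carrier_zero free_carrier_var

lemma free_ring_simps [simp]:
  "mult (free_ring n) = (*)" "one (free_ring n) = 1" "zero (free_ring n) = 0" "add (free_ring n) = (+)"
  by (simp_all add: free_ring_def)

lemma ring_free_ring: "ring (free_ring n)"
proof (rule ringI)
  show "abelian_group (free_ring n)"
  proof (rule abelian_groupI)
    show "\<exists>y\<in>carrier (free_ring n). y \<oplus>\<^bsub>free_ring n\<^esub> x = \<zero>\<^bsub>free_ring n\<^esub>"
      if "x \<in> carrier (free_ring n)" for x
      by (rule bexI[of _ "- x"]) (use that in simp_all)
  qed (simp_all add: add_ac)
  show "Group.monoid (free_ring n)"
    by (rule monoidI) (simp_all add: mult.assoc)
qed (simp_all add: distrib_left distrib_right)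

lemma free_ring_a_inv [simp]:
  assumes "p \<in> carrier (free_ring n)"
  shows "\<ominus>\<^bsub>free_ring n\<^esub> p = - p"
proof -
  interpret ring "free_ring n" by (rule ring_free_ring)
  show ?thesis using assms by (intro minus_equality) simp_all
qed

lemma uq_relators_carrier: "uq_relators n \<subseteq> carrier (free_ring n)"
proof -
  have "serre GenE i j \<in> carrier (free_ring n)" "serre GenF i j \<in> carrier (free_ring n)"
    if "i \<in> {1..<n}" "j \<in> {1..<n}" for i j
    using that by (simp_all add: serre_def)
  then show ?thesis
    unfolding uq_relators_def by auto
qed

lemma ideal_uq_ideal: "ideal (uq_ideal n) (free_ring n)"
  unfolding uq_ideal_def
  by (rule ring.genideal_ideal[OF ring_free_ring uq_relators_carrier])

text \<open>The elements killing every vector form a two-sided ideal containing the relators, and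
  the generated ideal is the least such ideal.\<close>

lemma uq_ideal_acts_zero:
  assumes "p \<in> uq_ideal n"
  shows "free_act p v = 0"
proof -
  let ?I = "{p \<in> carrier (free_ring n). \<forall>v. free_act p v = 0}"
  interpret ring "free_ring n" by (rule ring_free_ring)
  have "additive_subgroup ?I (free_ring n)"
    by (rule additive_subgroup.intro, rule add.subgroupI)
      (auto simp: free_act_add free_act_uminus simp flip: a_inv_def)
  then have "ideal ?I (free_ring n)"
    by (rule idealI[OF ring_axioms, OF additive_subgroup.a_subgroup])
      (auto simp: free_act_mult free_act_linear)
  then have "uq_ideal n \<subseteq> ?I"
    unfolding uq_ideal_def using uq_relators_carrier[of n] relator_acts_zero
    by (intro genideal_minimal) auto
  with assms show ?thesis by auto
qed

lemma ring_hom_uq_class: "ring_hom_ring (free_ring n) (Uq n) (uq_class n)"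
  unfolding Uq_def using ideal.rcos_ring_hom_ring[OF ideal_uq_ideal]
  by (simp add: uq_class_def[abs_def])

lemma ring_Uq: "ring (Uq n)"
  using ring_hom_uq_class[of n] by (rule ring_hom_ring.axioms)

context
  fixes n :: nat
begin

interpretation ring_hom_ring "free_ring n" "Uq n" "uq_class n"
  by (rule ring_hom_uq_class)

lemma uq_class_add:
  "p \<in> carrier (free_ring n) \<Longrightarrow> p' \<in> carrier (free_ring n) \<Longrightarrow>
    uq_class n p \<oplus>\<^bsub>Uq n\<^esub> uq_class n p' = uq_class n (p + p')"
  using hom_add[of p p'] by simp

lemma uq_class_mult:
  "p \<in> carrier (free_ring n) \<Longrightarrow> p' \<in> carrier (free_ring n) \<Longrightarrow>
    uq_class n p \<otimes>\<^bsub>Uq n\<^esub> uq_class n p' = uq_class n (p * p')"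
  using hom_mult[of p p'] by simp

lemma uq_class_uminus:
  "p \<in> carrier (free_ring n) \<Longrightarrow> \<ominus>\<^bsub>Uq n\<^esub> uq_class n p = uq_class n (- p)"
  using hom_a_inv[of p] by simp

lemma uq_class_pow:
  fixes k :: nat
  assumes p: "p \<in> carrier (free_ring n)"
  shows "uq_class n p [^]\<^bsub>Uq n\<^esub> k = uq_class n (p ^ k)"
proof (induction k)
  case 0
  show ?case using hom_one by simp
next
  case (Suc k)
  have "p ^ k \<in> carrier (free_ring n)" by (induction k) (simp_all add: p)
  then show ?case using Suc hom_mult[of "p ^ k" p] p by (simp add: power_Suc2 del: power_Suc)
qed

lemma uq_scale_class:
  "p \<in> carrier (free_ring n) \<Longrightarrow> uq_scale n c (uq_class n p) = uq_class n (scl c * p)"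
  using hom_mult[of "scl c" p] by (simp add: uq_scale_def)

end

lemma uq_class_eqI:
  assumes "p \<in> carrier (free_ring n)" "p' \<in> carrier (free_ring n)" "p - p' \<in> uq_ideal n"
  shows "uq_class n p = uq_class n p'"
  using ring.quotient_eq_iff_same_a_r_cos[OF ring_free_ring ideal_uq_ideal assms(1,2)] assms
  by (simp add: uq_class_def a_minus_def)

lemma uq_class_one: "\<one>\<^bsub>Uq n\<^esub> = uq_class n 1"
  using ring_hom_one[OF ring_hom_ring.homh[OF ring_hom_uq_class]] by simp

lemma uq_class_zero: "\<zero>\<^bsub>Uq n\<^esub> = uq_class n 0"
  using ring_hom_zero[OF ring_hom_ring.homh[OF ring_hom_uq_class] ring_free_ring ring_Uq] by simp

text \<open>Members of the coset differ by elements of the ideal, which act as zero. So the image in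
  the definition of \<open>uq_act\<close> is a singleton, and any representative computes the
  action.\<close>

lemma uq_act_class: "uq_act (uq_class n p) v = free_act p v"
proof -
  interpret ideal "uq_ideal n" "free_ring n" by (rule ideal_uq_ideal)
  have "uq_class n p = (\<lambda>h. h + p) ` uq_ideal n"
    by (auto simp: uq_class_def a_r_coset_def')
  moreover have "uq_ideal n \<noteq> {}" using a_subset additive_subgroup.zero_closed[OF is_additive_subgroup] by blast
  ultimately have "(\<lambda>p. free_act p v) ` uq_class n p = {free_act p v}"
    by (auto simp: image_image free_act_add uq_ideal_acts_zero)
  then show ?thesis by (simp add: uq_act_def)
qed

section \<open>Representatives that are combinations of words in the F\<close>

definition F_words :: "nat \<Rightarrow> freealg set"
  where "F_words n = {p. \<forall>w\<in>Poly_Mapping.keys p. letters w \<in> lists (GenF ` {1..<n})}"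

lemma F_words_carrier: "F_words n \<subseteq> carrier (free_ring n)"
  by (fastforce simp: F_words_def free_ring_def)

lemma F_words_add: "p \<in> F_words n \<Longrightarrow> p' \<in> F_words n \<Longrightarrow> p + p' \<in> F_words n"
  using keys_add[of p p'] by (auto simp: F_words_def)

lemma F_words_uminus: "p \<in> F_words n \<Longrightarrow> - p \<in> F_words n"
  by (auto simp: F_words_def in_keys_iff)

lemma F_words_mult:
  assumes "p \<in> F_words n" "p' \<in> F_words n"
  shows "p * p' \<in> F_words n"
  unfolding F_words_def
proof (rule CollectI, rule ballI)
  fix w
  assume "w \<in> Poly_Mapping.keys (p * p')"
  then obtain a b where "w = a + b" "a \<in> Poly_Mapping.keys p" "b \<in> Poly_Mapping.keys p'"
    using keys_mult[of p p'] by blast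
  with assms show "letters w \<in> lists (GenF ` {1..<n})" by (simp add: F_words_def plus_word_def)
qed

lemma F_words_scl: "scl c \<in> F_words n"
  by (auto simp: F_words_def scl_def zero_word_def)

lemma F_words_pow: "p \<in> F_words n \<Longrightarrow> p ^ k \<in> F_words n"
  using F_words_scl[of 1 n] by (induction k) (auto simp: F_words_mult scl_def)

lemma F_words_var: "i \<in> {1..<n} \<Longrightarrow> var (GenF i) \<in> F_words n"
  by (auto simp: F_words_def var_def)

lemma divF_class:
  assumes "i \<in> {1..<n}"
  shows "divF n i k = uq_class n (scl (1 / qfact k) * var (GenF i) ^ k)"
    "scl (1 / qfact k) * var (GenF i) ^ k \<in> F_words n"
proof -
  have v: "var (GenF i) \<in> F_words n" using assms by (rule F_words_var)
  then show "scl (1 / qfact k) * var (GenF i) ^ k \<in> F_words n"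
    by (intro F_words_mult F_words_scl F_words_pow)
  have "var (GenF i) ^ k \<in> carrier (free_ring n)" "var (GenF i) \<in> carrier (free_ring n)"
    using F_words_pow[OF v] F_words_carrier[of n] v by auto
  then show "divF n i k = uq_class n (scl (1 / qfact k) * var (GenF i) ^ k)"
    by (simp add: divF_def uq_class_pow uq_scale_class)
qed

text \<open>Only the letters of the representative are recorded, since coefficients at tableaux are
  compared word by word.\<close>

lemma UminusZ_F_words:
  assumes "u \<in> UminusZ n"
  obtains p where "p \<in> F_words n" "u = uq_class n p"
proof -
  have c: "p \<in> F_words n \<Longrightarrow> p \<in> carrier (free_ring n)" for p
    using F_words_carrier[of n] by auto
  have "\<exists>p\<in>F_words n. u = uq_class n p"
    using assms unfolding UminusZ_def
  proof induction
    case one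
    then show ?case
      using F_words_scl[of 1 n] by (intro bexI[of _ 1]) (simp_all add: uq_class_one scl_def)
  next
    case (incl h)
    then show ?case
    proof
      assume "h \<in> (\<lambda>c. uq_class n (scl c)) ` laurent_ring"
      then show ?thesis using F_words_scl[of _ n] by blast
    next
      assume "h \<in> {divF n i k |i k. i \<in> {1..<n}}"
      then show ?thesis using divF_class[of _ n] by blast
    qed
  next
    case (a_inv h)
    then obtain p where "p \<in> F_words n" "h = uq_class n p" by blast
    then show ?case
      using F_words_uminus[of p n] c by (intro bexI[of _ "- p"]) (simp_all add: uq_class_uminus)
  next
    case (eng_add h1 h2)
    then obtain p p' where "p \<in> F_words n" "h1 = uq_class n p" "p' \<in> F_words n" "h2 = uq_class n p'"
      by blast
    then show ?case
      using F_words_add[of p n p'] c by (intro bexI[of _ "p + p'"]) (simp_all add: uq_class_add)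
  next
    case (eng_mult h1 h2)
    then obtain p p' where "p \<in> F_words n" "h1 = uq_class n p" "p' \<in> F_words n" "h2 = uq_class n p'"
      by blast
    then show ?case
      using F_words_mult[of p n p'] c by (intro bexI[of _ "p * p'"]) (simp_all add: uq_class_mult)
  qed
  with that show thesis by auto
qed

section \<open>Large weights\<close>

definition F_monomial :: "nat list \<Rightarrow> freealg"
  where "F_monomial is = Poly_Mapping.single (Word (map GenF is)) 1"

lemma F_monomial_simps:
  "F_monomial [] = 1" "F_monomial (i # is) = var (GenF i) * F_monomial is"
  by (simp_all add: F_monomial_def var_def mult_single plus_word_def flip: zero_word_def)

lemma F_monomial_F_words: "set is \<subseteq> {1..<n} \<Longrightarrow> F_monomial is \<in> F_words n"
  by (force simp: F_monomial_def F_words_def)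

lemma F_monomial_carrier: "set is \<subseteq> {1..<n} \<Longrightarrow> F_monomial is \<in> carrier (free_ring n)"
  using F_monomial_F_words F_words_carrier by blast

lemma F_monomial_UminusZ:
  assumes "set is \<subseteq> {1..<n}"
  shows "uq_class n (F_monomial is) \<in> UminusZ n"
  using assms
proof (induction "is")
  case Nil
  show ?case
    using generate_ring.one[of "Uq n"] by (simp add: UminusZ_def F_monomial_simps uq_class_one)
next
  case (Cons i "is")
  have "scl 1 = (1 :: freealg)" by (simp add: scl_def)
  then have "uq_class n (var (GenF i)) = divF n i 1"
    using divF_class(1)[of i n 1] Cons.prems by (simp add: qfact_def)
  then have "uq_class n (var (GenF i)) \<in> UminusZ n"
    unfolding UminusZ_def using Cons.prems by (intro generate_ring.incl) auto
  with Cons have "uq_class n (var (GenF i)) \<otimes>\<^bsub>Uq n\<^esub> uq_class n (F_monomial is) \<in> UminusZ n"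
    unfolding UminusZ_def by (intro generate_ring.eng_mult) auto
  then show ?case
    using Cons.prems by (simp add: uq_class_mult F_monomial_simps F_monomial_carrier)
qed

lemma scl_commute: "scl c * p = p * scl c"
  by (induction p rule: poly_mapping_add_induct)
    (simp_all add: distrib_left distrib_right scl_def mult_single mult.commute)

lemma scl_mult: "scl a * scl b = scl (a * b)"
  by (simp add: scl_def mult_single)

lemma uq_class_mult_cong:
  assumes "uq_class n p = uq_class n p'" "uq_class n r = uq_class n r'"
    and "{p, p', r, r'} \<subseteq> carrier (free_ring n)"
  shows "uq_class n (p * r) = uq_class n (p' * r')"
  using assms by (simp flip: uq_class_mult)

lemma uq_class_relator:
  assumes "p - p' \<in> uq_relators n" "p \<in> carrier (free_ring n)" "p' \<in> carrier (free_ring n)"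
  shows "uq_class n p = uq_class n p'"
  using assms ring.genideal_self[OF ring_free_ring uq_relators_carrier, of n]
  by (intro uq_class_eqI) (auto simp: uq_ideal_def)

text \<open>K^-1 K, inserted after the leading letter, splits the conjugated monomial into a
  conjugated letter and a conjugated shorter monomial. The identity is needed in the algebra itself,
  whose weight spaces are defined by conjugation.\<close>

lemma K_F_monomial:
  assumes "set is \<subseteq> {1..<n}" and i: "i \<in> {1..<n}"
  shows "uq_class n (var (GenK i) * F_monomial is * var (GenKinv i)) =
    uq_class n (scl (qq powi (- (\<Sum>j\<leftarrow>is. cartan i j))) * F_monomial is)"
  using assms(1)
proof (induction "is")
  case Nil
  have "var (GenK i) * var (GenKinv i) - 1 \<in> uq_relators n" using i by (auto simp: uq_relators_def)
  with i show ?case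
    by (simp add: uq_class_relator F_monomial_simps scl_def)
next
  case (Cons j "is")
  let ?C = "carrier (free_ring n)"
  let ?K = "var (GenK i)" and ?L = "var (GenKinv i)" and ?F = "var (GenF j)" and ?M = "F_monomial is"
  let ?c = "qq powi (- cartan i j)" and ?d = "qq powi (- (\<Sum>j\<leftarrow>is. cartan i j))"
  have C [simp]: "?K \<in> ?C" "?L \<in> ?C" "?F \<in> ?C" "?M \<in> ?C"
    using Cons.prems i by (simp_all add: F_monomial_carrier)
  have "?L * ?K - 1 \<in> uq_relators n" using i by (auto simp: uq_relators_def)
  then have LK: "uq_class n (?L * ?K) = uq_class n 1" by (rule uq_class_relator) simp_all
  have "?K * ?F * ?L - scl ?c * ?F \<in> uq_relators n"
    unfolding uq_relators_def
    by (rule UnI1, rule UnI2, rule UN_I[OF i], rule UN_I[of j]) (use Cons.prems in auto)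
  then have KFL: "uq_class n (?K * ?F * ?L) = uq_class n (scl ?c * ?F)"
    by (rule uq_class_relator) simp_all
  have "uq_class n (?K * ?F * 1 * (?M * ?L)) = uq_class n (?K * ?F * (?L * ?K) * (?M * ?L))"
    by (rule uq_class_mult_cong, rule uq_class_mult_cong) (use LK in simp_all)
  also have "?K * ?F * (?L * ?K) * (?M * ?L) = (?K * ?F * ?L) * (?K * ?M * ?L)"
    by (simp add: mult.assoc)
  also have "uq_class n \<dots> = uq_class n ((scl ?c * ?F) * (scl ?d * ?M))"
    by (rule uq_class_mult_cong) (use KFL Cons in simp_all)
  also have "(scl ?c * ?F) * (scl ?d * ?M) = scl ?c * (?F * scl ?d) * ?M" by (simp add: mult.assoc)
  also have "\<dots> = scl (?c * ?d) * (?F * ?M)"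
    by (simp add: mult.assoc flip: scl_commute[of ?d ?F] scl_mult)
  also have "?c * ?d = qq powi (- (\<Sum>j\<leftarrow>j # is. cartan i j))"
    by (simp flip: power_int_add)
  finally show ?case by (simp add: F_monomial_simps mult.assoc)
qed

section \<open>Matrix coefficients of the generators\<close>

lemma coef_tensor_col: "coef (tensor_col x v) t = (case t of [] \<Rightarrow> 0 | y # t' \<Rightarrow> if x = y then coef v t' else 0)"
  by (induction v rule: poly_mapping_add_induct)
    (auto simp: tensor_col_linear lookup_add lookup_single when_def split: list.splits)

text \<open>The transpose of F_c: from the coefficients of v it computes the coefficient of F_c v at
  a given tableau, by undoing F on one column. It takes arbitrary functions because the recursion
  restricts to tableaux with a fixed first column.\<close>

primrec F_transpose :: "nat \<Rightarrow> (tableau \<Rightarrow> ratfun) \<Rightarrow> tableau \<Rightarrow> ratfun"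
  where
    "F_transpose c f [] = 0"
  | "F_transpose c f (y # t) =
      (if Suc c \<in> set y \<and> c \<notin> set y then f (col_replace (Suc c) c y # t) else 0)
      + K_col c y * F_transpose c (\<lambda>t. f (y # t)) t"

lemma F_transpose_add: "F_transpose c (\<lambda>t. f t + g t) t = F_transpose c f t + F_transpose c g t"
  by (induction t arbitrary: f g) (simp_all add: algebra_simps)

lemma F_transpose_scale: "F_transpose c (\<lambda>t. a * f t) t = a * F_transpose c f t"
  by (induction t arbitrary: f) (simp_all add: algebra_simps)

lemma F_transpose_zero [simp]: "F_transpose c (\<lambda>t. 0) t = 0"
  by (induction t) simp_all

lemma coef_F_tab: "coef (F_tab c s) t = F_transpose c (coef (basis_vec s)) t"
proof (induction s arbitrary: t)
  case Nil
  have "coef (basis_vec []) (y # t) = 0" for y t by (simp add: lookup_single)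
  then show ?case by (cases t) simp_all
next
  case (Cons x s)
  show ?case
  proof (cases t)
    case t: (Cons y t')
    \<comment> \<open>Under the side conditions raising x to y and lowering y to x undo each other,
      so \<open>F_tab\<close> and \<open>F_transpose\<close> single out the same pairs of
      columns.\<close>
    have eq: "x = col_replace (Suc c) c y" "y = col_replace c (Suc c) x"
      if "c \<in> set x \<and> Suc c \<notin> set x \<and> col_replace c (Suc c) x = y
        \<or> Suc c \<in> set y \<and> c \<notin> set y \<and> x = col_replace (Suc c) c y"
      using that by (auto simp: col_replace_inverse)
    have iff: "c \<in> set x \<and> Suc c \<notin> set x \<and> col_replace c (Suc c) x = y \<longleftrightarrow>
        Suc c \<in> set y \<and> c \<notin> set y \<and> x = col_replace (Suc c) c y"
      using eq by (metis mem_col_replace n_not_Suc_n)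
    have "(\<lambda>t. coef (basis_vec (x # s)) (y # t)) = (\<lambda>t. if x = y then coef (basis_vec s) t else 0)"
      by (auto simp: lookup_single when_def)
    then have "F_transpose c (\<lambda>t. coef (basis_vec (x # s)) (y # t)) t' =
        (if x = y then coef (F_tab c s) t' else 0)"
      by (simp add: Cons.IH)
    then have "F_transpose c (coef (basis_vec (x # s))) t =
        (if (Suc c \<in> set y \<and> c \<notin> set y \<and> x = col_replace (Suc c) c y) \<and> s = t' then 1 else 0)
        + (if x = y then K_col c x * coef (F_tab c s) t' else 0)"
      by (simp add: t lookup_single when_def)
    also have "\<dots> = (if (c \<in> set x \<and> Suc c \<notin> set x \<and> col_replace c (Suc c) x = y) \<and> s = t' then 1 else 0)
        + (if x = y then K_col c x * coef (F_tab c s) t' else 0)"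
      by (simp only: iff)
    also have "\<dots> = coef (F_tab c (x # s)) t"
      by (simp add: t lookup_add coef_tensor_col lookup_single when_def)
    finally show ?thesis ..
  qed (simp add: lookup_add coef_tensor_col lookup_single)
qed

lemma coef_gen_F: "coef (gen_act (GenF c) v) t = F_transpose c (coef v) t"
proof (induction v rule: poly_mapping_add_induct)
  case (add v s a)
  have "coef (Poly_Mapping.single s a) = (\<lambda>t. a * coef (basis_vec s) t)"
    by (auto simp: lookup_single when_def)
  then have "coef (Poly_Mapping.single s a + v) = (\<lambda>t. a * coef (basis_vec s) t + coef v t)"
    by (simp add: lookup_add fun_eq_iff)
  with add show ?case
    by (simp add: gen_act_linear lookup_add F_transpose_add F_transpose_scale coef_F_tab)
next
  case zero
  have "coef 0 = (\<lambda>t :: tableau. 0 :: ratfun)" by auto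
  then show ?case by simp
qed

lemma F_transpose_nonneg:
  assumes "\<And>t. f t \<ge> 0"
  shows "F_transpose c f t \<ge> 0"
  using assms
proof (induction t arbitrary: f)
  case (Cons y t)
  have "K_col c y \<ge> 0" by (simp add: K_col_def less_imp_le)
  then show ?case using Cons by simp
qed simp

lemma F_transpose_pos:
  assumes "\<And>t. f t \<ge> 0" and "f (a @ col_replace (Suc c) c y # b) > 0"
    and "Suc c \<in> set y" "c \<notin> set y"
  shows "F_transpose c f (a @ y # b) > 0"
  using assms(1,2)
proof (induction a arbitrary: f)
  case Nil
  have "K_col c y \<ge> 0" by (simp add: K_col_def less_imp_le)
  with Nil show ?case using assms(3,4) by (simp add: F_transpose_nonneg add_pos_nonneg)
next
  case (Cons x a)
  have "K_col c x > 0" by (simp add: K_col_def)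
  with Cons show ?case by (simp add: add_nonneg_pos)
qed

text \<open>Turns a nonzero coefficient into a predecessor of the tableau; counting arguments and
  congruences for \<open>F_transpose\<close> go through it.\<close>

lemma F_transpose_nonzero:
  assumes "F_transpose c f t \<noteq> 0"
  obtains a y b where "t = a @ y # b" "Suc c \<in> set y" "c \<notin> set y"
    "f (a @ col_replace (Suc c) c y # b) \<noteq> 0"
  using assms
proof (induction t arbitrary: f thesis)
  case (Cons x t)
  show ?case
  proof (cases "Suc c \<in> set x \<and> c \<notin> set x \<and> f (col_replace (Suc c) c x # t) \<noteq> 0")
    case True
    then show ?thesis using Cons.prems(1)[of "[]"] by simp
  next
    case False
    then have "F_transpose c (\<lambda>t. f (x # t)) t \<noteq> 0" using Cons.prems(2) by (auto split: if_splits)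
    then obtain a y b where "t = a @ y # b" "Suc c \<in> set y" "c \<notin> set y"
        "f (x # a @ col_replace (Suc c) c y # b) \<noteq> 0"
      by (rule Cons.IH[rotated])
    then show ?thesis using Cons.prems(1)[of "x # a"] by simp
  qed
qed simp

section \<open>Monomials are nonzero, yet high powers kill a given basis vector\<close>

lemma free_act_F_monomial: "free_act (F_monomial is) v = word_act (map GenF is) v"
  by (simp add: F_monomial_def free_act_single)

lemma F_monomial_nonzero:
  assumes "set is \<subseteq> {1..<n}"
  shows "uq_class n (F_monomial is) \<noteq> \<zero>\<^bsub>Uq n\<^esub>"
proof
  have nonneg: "coef (word_act (map GenF is) (basis_vec s)) t \<ge> 0" for "is" s t
    by (induction "is" arbitrary: t) (auto simp: lookup_single when_def coef_gen_F F_transpose_nonneg)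
  \<comment> \<open>One box per letter: the letter i moves its own box from i to i + 1. The prefix
    \<open>a\<close> holds the boxes of letters already peeled off from the left, still unmoved
    because those letters act later.\<close>
  have pos: "coef (word_act (map GenF is) (basis_vec (a @ map (\<lambda>i. [i]) is)))
      (a @ map (\<lambda>i. [Suc i]) is) > 0" for a
  proof (induction "is" arbitrary: a)
    case (Cons i "is")
    have "coef (word_act (map GenF is) (basis_vec (a @ [i] # map (\<lambda>i. [i]) is)))
        (a @ col_replace (Suc i) i [Suc i] # map (\<lambda>i. [Suc i]) is) > 0"
      using Cons.IH[of "a @ [[i]]"] by (simp add: col_replace_def)
    then show ?case using nonneg by (simp add: coef_gen_F F_transpose_pos)
  qed simp
  assume "uq_class n (F_monomial is) = \<zero>\<^bsub>Uq n\<^esub>"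
  then have "free_act (F_monomial is) v = 0" for v
    using uq_act_class[of n "F_monomial is" v] uq_act_class[of n 0 v] by (simp add: uq_class_zero)
  with pos[of "[]"] show False by (simp add: free_act_F_monomial)
qed

text \<open>Every application of F_k uses up exactly one column with k but without k + 1, and
  creates none.\<close>

lemma F_power_vanishes:
  assumes "m > length (filter (\<lambda>x. k \<in> set x \<and> Suc k \<notin> set x) s)"
  shows "word_act (replicate m (GenF k)) (basis_vec s) = 0"
proof -
  define cnt where "cnt t = length (filter (\<lambda>x. k \<in> set x \<and> Suc k \<notin> set x) t)" for t :: tableau
  have *: "cnt t + m = cnt s" if "coef (word_act (replicate m (GenF k)) (basis_vec s)) t \<noteq> 0" for t
    using that
  proof (induction m arbitrary: t)
    case 0
    then show ?case by (auto simp: lookup_single when_def split: if_splits)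
  next
    case (Suc m)
    then have "F_transpose k (coef (word_act (replicate m (GenF k)) (basis_vec s))) t \<noteq> 0"
      by (simp add: coef_gen_F)
    then obtain a y b where t: "t = a @ y # b" "Suc k \<in> set y" "k \<notin> set y"
      "coef (word_act (replicate m (GenF k)) (basis_vec s)) (a @ col_replace (Suc k) k y # b) \<noteq> 0"
      by (rule F_transpose_nonzero)
    then have "cnt (a @ col_replace (Suc k) k y # b) = Suc (cnt t)"
      by (simp add: cnt_def mem_col_replace)
    with Suc.IH[OF t(4)] show ?case by simp
  qed
  show ?thesis
  proof (rule poly_mapping_eqI, rule ccontr)
    fix t
    assume "coef (word_act (replicate m (GenF k)) (basis_vec s)) t \<noteq> coef 0 t"
    then show False using *[of t] assms by (simp add: cnt_def)
  qed
qed

section \<open>Columns of highest weight do not contribute\<close>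

abbreviation top_col :: "nat \<Rightarrow> nat list"
  where "top_col j \<equiv> [1..<Suc j]"

text \<open>What a special standard tableau guarantees for a column y to the right of a top column
  of height j, in a form that is kept when an F is undone.\<close>

definition follows :: "nat \<Rightarrow> nat list \<Rightarrow> bool"
  where "follows j y \<longleftrightarrow> j \<le> length y \<and> butlast y = [1..<length y] \<and> (length y = j \<longrightarrow> y = top_col j)"

lemma F_transpose_cong:
  assumes "\<And>a y b. t = a @ y # b \<Longrightarrow> Suc c \<in> set y \<Longrightarrow> c \<notin> set y \<Longrightarrow>
    f (a @ col_replace (Suc c) c y # b) = g (a @ col_replace (Suc c) c y # b)"
  shows "F_transpose c f t = F_transpose c g t"
proof (rule ccontr)
  assume "F_transpose c f t \<noteq> F_transpose c g t"
  then have "F_transpose c (\<lambda>t. f t + - 1 * g t) t \<noteq> 0"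
    unfolding F_transpose_add F_transpose_scale by simp
  then show False by (rule F_transpose_nonzero) (use assms in auto)
qed

text \<open>This excludes the factor q: a column still to be lowered from j + 1 to j lacks
  j.\<close>

lemma follows_mem:
  assumes "follows j y" "1 \<le> j"
  shows "j \<in> set y"
proof (cases "length y = j")
  case False
  then have "j \<in> set (butlast y)" using assms by (simp add: follows_def)
  then show ?thesis by (rule in_set_butlastD)
qed (use assms in \<open>auto simp: follows_def\<close>)

text \<open>As 1 \<le> c, an entry c + 1 without c lies neither in the initial segment
  \<open>butlast y\<close> nor in a top column. So the lowered entry is the last one, and y is
  higher than j.\<close>

lemma follows_lower:
  assumes y: "follows j y" and j: "1 \<le> j" and c: "1 \<le> c" "Suc c \<in> set y" "c \<notin> set y"
  shows "follows j (col_replace (Suc c) c y)"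
proof -
  have "Suc c \<notin> set (butlast y)"
  proof
    assume "Suc c \<in> set (butlast y)"
    then have "c \<in> set (butlast y)" using y c(1) by (simp add: follows_def)
    then show False using c(3) by (blast dest: in_set_butlastD)
  qed
  then have "butlast (col_replace (Suc c) c y) = butlast y"
    by (auto simp: col_replace_def map_butlast[symmetric] intro!: map_idI)
  moreover have "length y \<noteq> j"
  proof
    assume "length y = j"
    then have "y = top_col j" using y by (simp add: follows_def del: upt_Suc)
    then have "set y = {1..j}" by (simp add: atLeastLessThanSuc_atLeastAtMost del: upt_Suc)
    with c show False by auto
  qed
  ultimately show ?thesis using y by (simp add: follows_def col_replace_def)
qed

text \<open>
  The factor contributed by K acting on an inserted column of height j is 1 except for c = j; but
  no column to its right can have arisen from the action of F with index j.
\<close>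

lemma F_transpose_insert:
  assumes c: "1 \<le> c" and j: "1 \<le> j" and b: "\<forall>y\<in>set b. follows j y"
    and "\<And>a'. length a' = length a \<Longrightarrow> f (a' @ top_col j # b) = g (a' @ b)"
    and "\<And>b'. length b' = length b \<Longrightarrow> \<forall>y\<in>set b'. follows j y \<Longrightarrow> f (a @ top_col j # b') = g (a @ b')"
  shows "F_transpose c f (a @ top_col j # b) = F_transpose c g (a @ b)"
  using assms(4,5)
proof (induction a arbitrary: f g)
  case Nil
  \<comment> \<open>The inserted column itself is never the one changed: as 1 \<le> c, it contains c
    along with c + 1.\<close>
  have no_lower: "\<not> (Suc c \<in> set (top_col j) \<and> c \<notin> set (top_col j))"
    using c by (simp add: atLeastLessThanSuc_atLeastAtMost del: upt_Suc)
  have "F_transpose c f (top_col j # b) = K_col c (top_col j) * F_transpose c (\<lambda>t. f (top_col j # t)) b"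
    by (simp only: F_transpose.simps if_not_P[OF no_lower] add_0)
  also have "\<dots> = F_transpose c (\<lambda>t. f (top_col j # t)) b"
  proof (cases "c = j")
    case True
    have "F_transpose c (\<lambda>t. f (top_col j # t)) b = 0"
    proof (rule ccontr)
      assume "F_transpose c (\<lambda>t. f (top_col j # t)) b \<noteq> 0"
      then show False
        by (rule F_transpose_nonzero) (use b j True follows_mem in auto)
    qed
    then show ?thesis by simp
  next
    case False
    then have "K_col c (top_col j) = 1" using c by (auto simp: K_col_def)
    then show ?thesis by simp
  qed
  also have "\<dots> = F_transpose c g b"
  proof (rule F_transpose_cong)
    fix l y r
    assume "b = l @ y # r" "Suc c \<in> set y" "c \<notin> set y"
    then show "f (top_col j # l @ col_replace (Suc c) c y # r) = g (l @ col_replace (Suc c) c y # r)"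
      using Nil(2)[of "l @ col_replace (Suc c) c y # r"] b c j by (simp add: follows_lower)
  qed
  finally show ?case by simp
next
  case (Cons x a)
  have "F_transpose c (\<lambda>t. f (x # t)) (a @ top_col j # b) = F_transpose c (\<lambda>t. g (x # t)) (a @ b)"
  proof (rule Cons.IH)
    show "f (x # a' @ top_col j # b) = g (x # a' @ b)" if "length a' = length a" for a'
      using Cons.prems(1)[of "x # a'"] that by simp
    show "f (x # a @ top_col j # b') = g (x # a @ b')"
      if "length b' = length b" "\<forall>y\<in>set b'. follows j y" for b'
      using Cons.prems(2)[of b'] that by simp
  qed
  moreover have "f (col_replace (Suc c) c x # a @ top_col j # b) = g (col_replace (Suc c) c x # a @ b)"
    using Cons.prems(1)[of "col_replace (Suc c) c x # a"] by simp
  ultimately show ?case by simp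
qed

text \<open>Through K a column feels only the F acting to its right, so the entries of
  \<open>a\<close> are arbitrary and \<open>b\<close> alone is constrained. Both vary in the
  induction, since removing the leftmost letter lowers an entry of the target; the source stays
  fixed.\<close>

lemma word_act_insert:
  assumes "set w \<subseteq> GenF ` {1..}" "1 \<le> j" "length A = length a" "length B = length b"
    and "\<forall>y\<in>set b. follows j y"
  shows "coef (word_act w (basis_vec (A @ top_col j # B))) (a @ top_col j # b) =
    coef (word_act w (basis_vec (A @ B))) (a @ b)"
  using assms
proof (induction w arbitrary: a b)
  case Nil
  then show ?case by (simp add: lookup_single when_def)
next
  case (Cons g w)
  then obtain c where c: "g = GenF c" "1 \<le> c" by auto
  have "F_transpose c (coef (word_act w (basis_vec (A @ top_col j # B)))) (a @ top_col j # b) =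
      F_transpose c (coef (word_act w (basis_vec (A @ B)))) (a @ b)"
    using c Cons.prems by (intro F_transpose_insert Cons.IH) simp_all
  with c show ?case by (simp only: word_act_simps coef_gen_F)
qed

definition reduced :: "tableau \<Rightarrow> tableau"
  where "reduced t = filter (\<lambda>x. x \<noteq> top_col (length x)) t"

text \<open>The source has top columns of the same heights as t, so a column is deleted at the same
  position of source and target. The prefixes \<open>A\<close> and \<open>a\<close> account for
  columns already passed and kept.\<close>

lemma word_act_reduced_aux:
  assumes "set w \<subseteq> GenF ` {1..}" "length A = length a" "[] \<notin> set t"
    and "sorted_wrt (\<lambda>x y. x = top_col (length x) \<longrightarrow> follows (length x) y) t"
  shows "coef (word_act w (basis_vec (A @ map (\<lambda>x. top_col (length x)) t))) (a @ t) =
    coef (word_act w (basis_vec (A @ map (\<lambda>x. top_col (length x)) (reduced t)))) (a @ reduced t)"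
  using assms(2-)
proof (induction t arbitrary: A a)
  case (Cons x t)
  let ?top = "map (\<lambda>x. top_col (length x))"
  show ?case
  proof (cases "x = top_col (length x)")
    case True
    have "coef (word_act w (basis_vec (A @ top_col (length x) # ?top t))) (a @ top_col (length x) # t) =
        coef (word_act w (basis_vec (A @ ?top t))) (a @ t)"
      using Cons.prems assms(1) True by (intro word_act_insert) (auto simp: Suc_le_eq)
    with True Cons show ?thesis by (simp add: reduced_def del: upt_Suc)
  next
    case False
    then show ?thesis
      using Cons.IH[of "A @ [top_col (length x)]" "a @ [x]"] Cons.prems
      by (simp add: reduced_def del: upt_Suc)
  qed
qed (simp add: reduced_def)

lemma word_act_reduced:
  assumes "set w \<subseteq> GenF ` {1..}" "[] \<notin> set t"
    and "sorted_wrt (\<lambda>x y. x = top_col (length x) \<longrightarrow> follows (length x) y) t"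
    and "map length t = column_heights n lam"
  shows "coef (word_act w (highest_vec n lam)) t =
    coef (word_act w (basis_vec (map (\<lambda>x. top_col (length x)) (reduced t)))) (reduced t)"
proof -
  have "map (\<lambda>x. top_col (length x)) t = map top_col (map length t)" by (simp del: upt_Suc)
  also have "\<dots> = map top_col (column_heights n lam)" by (simp only: assms(4))
  finally show ?thesis
    using word_act_reduced_aux[OF assms(1) _ assms(2,3), of "[]" "[]"]
    by (simp add: highest_vec_def del: upt_Suc)
qed

section \<open>Special standard tableaux\<close>

text \<open>The columns 1, ..., h - 1, l with h \<le> l \<le> n; height and last entry determine
  them.\<close>

definition special_cols :: "nat \<Rightarrow> nat list set"
  where "special_cols n = {x. x \<noteq> [] \<and> butlast x = [1..<length x] \<and> length x \<le> last x \<and> last x \<le> n}"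

text \<open>
  A tableau with special columns is standard of some shape iff its columns are sorted by height
  and, within a given height, by decreasing last entry.
\<close>

definition col_key :: "nat \<Rightarrow> nat list \<Rightarrow> nat"
  where "col_key n x = length x * Suc n + (n - last x)"

text \<open>The second summand of the key stays below the multiplier \<open>Suc n\<close>, so the
  key orders lexicographically.\<close>

lemma col_key_le_iff:
  assumes "x \<in> special_cols n" "y \<in> special_cols n"
  shows "col_key n x \<le> col_key n y \<longleftrightarrow> length x < length y \<or> length x = length y \<and> last y \<le> last x"
proof -
  have less: "col_key n x < col_key n y" if "length x < length y" for x y
  proof -
    have "col_key n x < length x * Suc n + Suc n" by (simp add: col_key_def)
    also have "\<dots> = Suc (length x) * Suc n" by simp
    also have "\<dots> \<le> length y * Suc n" using that by (intro mult_le_mono1) simp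
    also have "\<dots> \<le> col_key n y" by (simp add: col_key_def)
    finally show ?thesis .
  qed
  consider "length x < length y" | "length y < length x" | "length x = length y" by linarith
  then show ?thesis
  proof cases
    case 3
    moreover from assms have "last x \<le> n" "last y \<le> n" by (auto simp: special_cols_def)
    ultimately show ?thesis by (auto simp: col_key_def)
  qed (use less[of x y] less[of y x] in auto)
qed

lemma special_col_eqI:
  assumes "x \<in> special_cols n" "y \<in> special_cols n" "length x = length y" "last x = last y"
  shows "x = y"
  using assms append_butlast_last_id[of x] append_butlast_last_id[of y]
  by (simp add: special_cols_def)

lemma inj_on_col_key: "inj_on (col_key n) (special_cols n)"
proof (rule inj_onI)
  fix x y
  assume *: "x \<in> special_cols n" "y \<in> special_cols n" "col_key n x = col_key n y"
  then have "col_key n x \<le> col_key n y" "col_key n y \<le> col_key n x" by simp_all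
  then show "x = y"
    unfolding col_key_le_iff[OF *(1,2)] col_key_le_iff[OF *(2,1)]
    by (intro special_col_eqI[OF *(1,2)]) auto
qed

lemma special_col_nth:
  assumes "x \<in> special_cols n" "r < length x"
  shows "x ! r = (if Suc r = length x then last x else Suc r)"
proof (cases "Suc r = length x")
  case True
  then show ?thesis using assms by (simp add: special_cols_def last_conv_nth flip: True)
next
  case False
  then have "x ! r = butlast x ! r" using assms by (simp add: nth_butlast)
  also have "\<dots> = Suc r" using assms False by (simp add: special_cols_def)
  finally show ?thesis using False by simp
qed

lemma special_col_eq_top:
  assumes "x \<in> special_cols n"
  shows "x = top_col (length x) \<longleftrightarrow> last x = length x"
proof
  assume eq: "x = top_col (length x)"
  have "length x \<ge> 1" using assms by (simp add: special_cols_def Suc_le_eq)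
  then have "last (top_col (length x)) = length x" by simp
  with eq show "last x = length x" by simp
next
  assume "last x = length x"
  moreover have "length x \<ge> 1" using assms by (simp add: special_cols_def Suc_le_eq)
  ultimately show "x = top_col (length x)"
    using assms append_butlast_last_id[of x] by (simp add: special_cols_def)
qed

lemma top_col_special:
  assumes "j \<in> {1..<n}"
  shows "top_col j \<in> special_cols n"
  using assms by (simp add: special_cols_def)

lemma strict_col_nth_ge:
  assumes "sorted_wrt (<) x" "set x \<subseteq> {1..}" "r < length x"
  shows "Suc r \<le> x ! r"
  using assms(3)
proof (induction r)
  case 0
  then have "x ! 0 \<in> {1..}" using assms(2) nth_mem by blast
  then show ?case by simp
next
  case (Suc r)
  then have "x ! r < x ! Suc r" using assms(1) by (simp add: sorted_wrt_nth_less)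
  with Suc show ?case by simp
qed

lemma special_cols_iff:
  assumes "sorted_wrt (<) x" "set x \<subseteq> {1..n}" "x \<noteq> []"
    and special: "\<forall>r<length x. x ! r > Suc r \<longrightarrow> Suc r = length x"
  shows "x \<in> special_cols n"
proof -
  have ge: "Suc r \<le> x ! r" if "r < length x" for r
    using assms(1,2) that by (intro strict_col_nth_ge) auto
  have "butlast x = [1..<length x]"
  proof (rule nth_equalityI)
    fix r assume r: "r < length (butlast x)"
    then have "x ! r = Suc r" using ge[of r] special by (metis Suc_lessI Suc_pred
        length_butlast length_pos_if_in_set le_neq_implies_less less_SucI less_irrefl
        length_greater_0_conv assms(3) less_diff_conv Suc_eq_plus1 less_imp_le_nat add_lessD1)
    then show "butlast x ! r = [1..<length x] ! r" using r by (simp add: nth_butlast)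
  qed simp
  moreover have "length x \<le> last x"
    using ge[of "length x - 1"] assms(3) by (simp add: last_conv_nth Suc_le_eq)
  moreover have "last x \<in> {1..n}" using assms(2) last_in_set[OF assms(3)] by blast
  then have "last x \<le> n" by simp
  ultimately show ?thesis using assms(3) by (simp add: special_cols_def)
qed

section \<open>Shapes as multisets of column heights\<close>

lemma sorted_column_heights: "sorted (column_heights n lam)"
proof -
  have "sorted (concat (map (\<lambda>j. replicate (lam j) j) [1..<m]))" for m
  proof (induction m)
    case (Suc m)
    then show ?case by (cases m) (auto simp: sorted_append)
  qed simp
  then show ?thesis by (simp add: column_heights_def)
qed

lemma count_column_heights:
  "count (mset (column_heights n lam)) j = (if j \<in> {1..<n} then lam j else 0)"
proof -
  have "count (mset (concat (map (\<lambda>j. replicate (lam j) j) [1..<m]))) j =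
    (if j \<in> {1..<m} then lam j else 0)" for m
  proof (induction m)
    case (Suc m)
    then show ?case by (cases m) auto
  qed simp
  then show ?thesis by (simp add: column_heights_def)
qed

lemma set_column_heights: "set (column_heights n lam) \<subseteq> {1..<n}"
  by (auto simp: column_heights_def)

text \<open>Equivalent to being a special standard tableau of shape lam. Heights enter only through
  multiplicities, so columns may be removed or added and the rest sorted again.\<close>

definition special_shape :: "nat \<Rightarrow> (nat \<Rightarrow> nat) \<Rightarrow> tableau \<Rightarrow> bool"
  where "special_shape n lam t \<longleftrightarrow> set t \<subseteq> special_cols n \<and> sorted (map (col_key n) t) \<and>
    (\<forall>j. length (filter (\<lambda>x. length x = j) t) = (if j \<in> {1..<n} then lam j else 0))"

lemma count_map_length: "count (mset (map length t)) j = length (filter (\<lambda>x. length x = j) t)"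
  by (induction t) auto

lemma special_shapeI:
  assumes t: "t \<in> std_tableaux n lam" and special: "special t"
  shows "special_shape n lam t"
proof -
  have len: "map length t = column_heights n lam"
    and cols: "\<forall>x\<in>set t. set x \<subseteq> {1..n} \<and> sorted_wrt (<) x" and std: "standard t"
    using t by (auto simp: std_tableaux_def tableaux_def)
  have "length x \<in> {1..<n}" if "x \<in> set t" for x
    using that set_column_heights[of n lam] by (auto simp flip: len)
  then have ne: "x \<noteq> []" if "x \<in> set t" for x using that by fastforce
  have sub: "set t \<subseteq> special_cols n"
  proof
    fix x
    assume x: "x \<in> set t"
    show "x \<in> special_cols n"
      by (rule special_cols_iff) (use x cols ne[OF x] special in \<open>auto simp: special_def\<close>)
  qed
  have "col_key n (t ! p) \<le> col_key n (t ! p')" if p: "p < p'" "p' < length t" for p p'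
  proof -
    have mem: "t ! p \<in> set t" "t ! p' \<in> set t" using p by auto
    then have S: "t ! p \<in> special_cols n" "t ! p' \<in> special_cols n" using sub by auto
    have "length (t ! p) \<le> length (t ! p')"
      using sorted_nth_mono[OF sorted_column_heights[of n lam], of p p'] p by (simp flip: len)
    moreover have "last (t ! p') \<le> last (t ! p)" if eq: "length (t ! p) = length (t ! p')"
    proof -
      have "t ! p' ! (length (t ! p) - 1) \<le> t ! p ! (length (t ! p) - 1)"
        using std p mem ne eq unfolding standard_def
        by (metis diff_less length_greater_0_conv zero_less_one)
      then show ?thesis using ne mem eq by (simp add: last_conv_nth)
    qed
    ultimately show ?thesis
      unfolding col_key_le_iff[OF S] by auto
  qed
  then have "sorted (map (col_key n) t)" by (simp add: sorted_wrt_iff_nth_less)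
  with sub show ?thesis
    using count_column_heights[of n lam] by (simp add: special_shape_def flip: len count_map_length)
qed

lemma special_shapeD:
  assumes "special_shape n lam t"
  shows "t \<in> std_tableaux n lam" "special t"
proof -
  have sub: "set t \<subseteq> special_cols n" and sorted: "sorted (map (col_key n) t)"
    using assms by (auto simp: special_shape_def)
  have order: "length (t ! p) < length (t ! p') \<or>
      length (t ! p) = length (t ! p') \<and> last (t ! p') \<le> last (t ! p)"
    if "p < p'" "p' < length t" for p p'
  proof -
    have "t ! p \<in> special_cols n" "t ! p' \<in> special_cols n" using that sub by auto
    note iff = col_key_le_iff[OF this]
    have "col_key n (t ! p) \<le> col_key n (t ! p')"
      using sorted_nth_mono[OF sorted, of p p'] that by simp
    then show ?thesis by (simp only: iff)
  qed
  have "mset (map length t) = mset (column_heights n lam)"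
    by (rule multiset_eqI) (use assms in \<open>simp only: count_map_length count_column_heights special_shape_def\<close>)
  moreover have "sorted (map length t)"
    unfolding sorted_wrt_map sorted_wrt_iff_nth_less using order by fastforce
  ultimately have len: "map length t = column_heights n lam"
    using sorted_column_heights by (metis properties_for_sort)
  have "set x \<subseteq> {1..n} \<and> sorted_wrt (<) x" if "x \<in> set t" for x
  proof -
    have x: "x \<noteq> []" "butlast x = [1..<length x]" "length x \<le> last x" "last x \<le> n"
      using that sub by (auto simp: special_cols_def)
    then have "x = [1..<length x] @ [last x]" using append_butlast_last_id[of x] by simp
    then obtain l h where "x = [1..<h] @ [l]" "h \<le> l" "l \<le> n" "1 \<le> h"
      using x by (metis length_greater_0_conv Suc_le_eq One_nat_def)
    then show ?thesis by (auto simp: sorted_wrt_append)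
  qed
  with len have "t \<in> tableaux n lam" by (simp add: tableaux_def)
  moreover have "standard t"
    unfolding standard_def
  proof (intro allI impI, elim conjE)
    fix p p' r
    assume *: "p < p'" "p' < length t" "r < length (t ! p)" "r < length (t ! p')"
    then have S: "t ! p \<in> special_cols n" "t ! p' \<in> special_cols n" using sub by auto
    \<comment> \<open>Needed when the left column is shorter: in its bottom row the right column has
      the row number as entry, and the last entry on the left is at least that.\<close>
    have "length (t ! p) \<le> last (t ! p)" using S by (simp add: special_cols_def)
    then show "t ! p' ! r \<le> t ! p ! r"
      using order[OF *(1,2)] * by (auto simp: special_col_nth[OF S(1)] special_col_nth[OF S(2)])
  qed
  ultimately show "t \<in> std_tableaux n lam" by (simp add: std_tableaux_def)
  show "special t"
    unfolding special_def
  proof (intro ballI allI impI)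
    fix x r
    assume "x \<in> set t" "r < length x" "Suc r < x ! r"
    then show "Suc r = length x"
      using sub special_col_nth[of x n r] by (auto split: if_splits)
  qed
qed

lemma sorted_col_key_unique:
  assumes "mset t = mset t'" "set t \<subseteq> special_cols n" 
    and "sorted (map (col_key n) t)" "sorted (map (col_key n) t')"
  shows "t = t'"
proof -
  have "map (col_key n) t = map (col_key n) t'"
    using assms by (metis mset_map properties_for_sort)
  moreover have "set t' = set t" using assms(1) by (metis set_mset_mset)
  ultimately show ?thesis
    using inj_on_subset[OF inj_on_col_key assms(2)] by (simp add: inj_on_map_eq_map)
qed

lemma sorted_key_reduced: "sorted (map f t) \<Longrightarrow> sorted (map f (reduced t))"
  by (simp add: reduced_def sorted_filter)

text \<open>The shape fixes the number of columns of each height, so the top columns are those that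
  \<open>reduced\<close> does not account for.\<close>

lemma special_shape_unique:
  assumes "special_shape n lam t" "special_shape n lam t'" "reduced t = reduced t'"
  shows "t = t'"
proof (rule sorted_col_key_unique[of _ _ n])
  have top: "count (mset t) (top_col h) + length (filter (\<lambda>y. length y = h) (reduced t)) =
      length (filter (\<lambda>y. length y = h) t)" for t :: tableau and h
    by (induction t) (auto simp: reduced_def simp del: upt_Suc)
  have other: "count (mset t) x = count (mset (reduced t)) x" if "x \<noteq> top_col (length x)"
    for t :: tableau and x
    using that by (simp add: reduced_def del: upt_Suc)
  have shape: "length (filter (\<lambda>x. length x = h) t) = length (filter (\<lambda>x. length x = h) t')" for h
    using assms by (simp add: special_shape_def)
  show "mset t = mset t'"
  proof (rule multiset_eqI)
    fix x
    show "count (mset t) x = count (mset t') x"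
    proof (cases "x = top_col (length x)")
      case True
      then show ?thesis
        using top[of t "length x"] top[of t' "length x"] shape[of "length x"] assms(3)
        by (metis add_right_cancel)
    next
      case False
      then show ?thesis using other[of x t] other[of x t'] assms(3) by simp
    qed
  qed
qed (use assms in \<open>auto simp: special_shape_def\<close>)

text \<open>Top columns are added until height j occurs lam j times, then everything is sorted.
  Deleting them again returns the old list, because a list sorted by an injective key is determined
  by its multiset.\<close>

lemma special_shape_exists:
  assumes t: "special_shape n lam' t"
    and fits: "\<And>j. j \<in> {1..<n} \<Longrightarrow> length (filter (\<lambda>x. length x = j) (reduced t)) \<le> lam j"
  obtains t' where "special_shape n lam t'" "reduced t' = reduced t"
proof -
  define fill where "fill = concat (map (\<lambda>j. replicate
    (lam j - length (filter (\<lambda>x. length x = j) (reduced t))) (top_col j)) [1..<n])"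
  define t' where "t' = sort_key (col_key n) (reduced t @ fill)"
  have fill_cols: "\<exists>j\<in>{1..<n}. x = top_col j" if "x \<in> set fill" for x
    using that by (auto simp: fill_def simp del: upt_Suc split: if_splits)
  have t_cols: "set t \<subseteq> special_cols n" and shape: "length (filter (\<lambda>x. length x = j) t) = (if j \<in> {1..<n} then lam' j else 0)" for j
    using t by (simp_all add: special_shape_def)
  have red_cols: "set (reduced t) \<subseteq> special_cols n" using t_cols by (auto simp: reduced_def)
  have cols: "set t' \<subseteq> special_cols n"
  proof
    fix x
    assume "x \<in> set t'"
    then consider "x \<in> set (reduced t)" | "x \<in> set fill" by (auto simp: t'_def)
    then show "x \<in> special_cols n"
      using red_cols fill_cols top_col_special by cases blast+
  qed
  have "length (filter (\<lambda>x. length x = j) fill) =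
      (if j \<in> {1..<n} then lam j - length (filter (\<lambda>x. length x = j) (reduced t)) else 0)" for j
  proof -
    have "length (filter (\<lambda>x. length x = j) (concat (map (\<lambda>j. replicate (f j) (top_col j)) [1..<m])))
      = (if j \<in> {1..<m} then f j else 0)" for m f
    proof (induction m)
      case (Suc m)
      then show ?case by (cases m) (auto simp: filter_replicate Suc_le_eq)
    qed simp
    then show ?thesis unfolding fill_def by simp
  qed
  moreover have "length (filter (\<lambda>x. length x = j) (reduced t)) = 0" if "j \<notin> {1..<n}" for j
  proof -
    have "length (filter (\<lambda>x. length x = j) t) = 0" by (subst shape) (use that in auto)
    then have "filter (\<lambda>x. length x = j) t = []" by simp
    then show ?thesis by (auto simp: reduced_def filter_empty_conv)
  qed
  moreover have "length (filter P t') = length (filter P (reduced t)) + length (filter P fill)" for P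
    by (simp add: t'_def filter_sort)
  ultimately have "length (filter (\<lambda>x. length x = j) t') = (if j \<in> {1..<n} then lam j else 0)" for j
    using fits[of j] by simp
  with cols have "special_shape n lam t'" by (simp add: special_shape_def t'_def)
  moreover have "reduced t' = reduced t"
  proof (rule sorted_col_key_unique)
    have "filter (\<lambda>x. x \<noteq> top_col (length x)) fill = []"
      using fill_cols by (fastforce simp: filter_empty_conv simp del: upt_Suc)
    then have "reduced t' = sort_key (col_key n) (reduced t)"
      by (simp add: reduced_def t'_def filter_sort del: upt_Suc)
    then show "mset (reduced t') = mset (reduced t)" by simp
    show "set (reduced t') \<subseteq> special_cols n" using cols by (auto simp: reduced_def)
    show "sorted (map (col_key n) (reduced t'))" by (rule sorted_key_reduced) (simp add: t'_def)
    show "sorted (map (col_key n) (reduced t))"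
      using t by (intro sorted_key_reduced) (simp add: special_shape_def)
  qed
  ultimately show thesis by (rule that)
qed

text \<open>Above its last entry a special column has the row numbers, which in the top k rows do
  not exceed k. So an entry r + 1 with r \<ge> k found there is the last entry of its
  column.\<close>

lemma entry_count_special:
  assumes "set t \<subseteq> special_cols n" "k \<le> r"
  shows "entry_count k r t = length (filter (\<lambda>x. length x \<le> k \<and> last x = Suc r) t)"
  using assms(1)
proof (induction t)
  case (Cons x t)
  define h l where "h = length x" and "l = last x"
  have x: "x = [1..<h] @ [l]" "1 \<le> h" "h \<le> l"
    using Cons.prems append_butlast_last_id[of x] by (auto simp: special_cols_def h_def l_def Suc_le_eq)
  have "set (take k [1..<h]) \<subseteq> {..k}" by (auto simp: in_set_conv_nth)
  then have "Suc r \<notin> set (take k [1..<h])" using assms(2) by auto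
  then have "count_list (take k x) (Suc r) = (if h \<le> k \<and> l = Suc r then 1 else 0)"
    using x by (auto simp: take_Cons')
  with Cons show ?case by (simp add: entry_count_def h_def l_def)
qed (simp add: entry_count_def)

text \<open>a_h^r - a_(h-1)^r counts the columns of height h with last entry r + 1. Height 1 is
  separate because the correspondence compares a_k^r for k \<ge> 1 only; the bounds keep the other
  indices in its range.\<close>

lemma count_special:
  assumes t: "set t \<subseteq> special_cols n" and x: "x \<in> special_cols n" "x \<noteq> top_col (length x)"
  shows "count (mset t) x = entry_count (length x) (last x - 1) t
    - (if length x = 1 then 0 else entry_count (length x - 1) (last x - 1) t)"
    "1 \<le> length x" "length x \<le> last x - 1" "last x - 1 \<le> n - 1"
proof -
  define h r where "h = length x" and "r = last x - 1"
  have "last x \<noteq> length x" using special_col_eq_top[OF x(1)] x(2) by simp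
  then have h: "1 \<le> h" "h \<le> r" "last x = Suc r" "r \<le> n - 1"
    using x(1) by (auto simp: special_cols_def h_def r_def Suc_le_eq)
  show "1 \<le> length x" "length x \<le> last x - 1" "last x - 1 \<le> n - 1"
    using h(1,2,4) unfolding h_def r_def by blast+
  have "count (mset t) x = length (filter (\<lambda>y. length y = h \<and> last y = Suc r) t)"
    using t
  proof (induction t)
    case (Cons y t)
    then have "y \<in> special_cols n" by simp
    then have "y = x \<longleftrightarrow> length y = h \<and> last y = Suc r"
      using special_col_eqI[OF _ x(1)] h(3) h_def by metis
    with Cons show ?case by simp
  qed simp
  moreover have "length (filter (\<lambda>y. length y \<le> h \<and> last y = Suc r) t) =
      length (filter (\<lambda>y. length y = h \<and> last y = Suc r) t)
      + length (filter (\<lambda>y. length y \<le> h - 1 \<and> last y = Suc r) t)"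
    using h(1) by (induction t) auto
  moreover have "filter (\<lambda>y. length y \<le> 0 \<and> last y = Suc r) t = []"
    using t by (auto simp: filter_empty_conv special_cols_def)
  ultimately show "count (mset t) x = entry_count (length x) (last x - 1) t
    - (if length x = 1 then 0 else entry_count (length x - 1) (last x - 1) t)"
    using h t by (auto simp: entry_count_special simp flip: h_def r_def)
qed

lemma reduced_eq_if_entry_count_eq:
  assumes t: "special_shape n lam t" and t': "special_shape n lam' t'"
    and eq: "\<And>k r. 1 \<le> k \<Longrightarrow> k \<le> r \<Longrightarrow> r \<le> n - 1 \<Longrightarrow> entry_count k r t = entry_count k r t'"
  shows "reduced t = reduced t'"
proof (rule sorted_col_key_unique[of _ _ n])
  have cols: "set t \<subseteq> special_cols n" "set t' \<subseteq> special_cols n"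
    using t t' by (simp_all add: special_shape_def)
  show "mset (reduced t) = mset (reduced t')"
  proof (rule multiset_eqI)
    fix x
    consider "x = top_col (length x)" | "x \<notin> special_cols n"
      | "x \<noteq> top_col (length x)" "x \<in> special_cols n" by blast
    then show "count (mset (reduced t)) x = count (mset (reduced t')) x"
    proof cases
      case 1
      then have "x \<notin> set (reduced t)" "x \<notin> set (reduced t')"
        by (simp_all add: reduced_def del: upt_Suc)
      then show ?thesis by (metis count_mset_0_iff)
    next
      case 2
      then have "x \<notin> set (reduced t)" "x \<notin> set (reduced t')"
        using cols by (auto simp: reduced_def)
      then show ?thesis by (metis count_mset_0_iff)
    next
      case 3
      note c = count_special[OF cols(1) 3(2,1)] and c' = count_special[OF cols(2) 3(2,1)]
      have "count (mset t) x = count (mset t') x"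
        unfolding c(1) c'(1)
        using eq[of "length x" "last x - 1"] eq[of "length x - 1" "last x - 1"] c(2-4) by auto
      with 3 show ?thesis by (simp add: reduced_def del: upt_Suc)
    qed
  qed
qed (use t t' in \<open>auto simp: special_shape_def reduced_def sorted_filter\<close>)

text \<open>A column of height j other than the top one has last entry r + 1 with r \<ge> j. So it
  is counted by a_j^r, and mu j is the sum of these over r.\<close>

lemma reduced_height_le_weight:
  assumes t: "special_shape n lam t" and w: "has_tab_weight n mu t" and j: "j \<in> {1..<n}"
  shows "length (filter (\<lambda>x. length x = j) (reduced t)) \<le> mu j"
proof -
  have cols: "set t \<subseteq> special_cols n" using t by (simp add: special_shape_def)
  then have "length (filter (\<lambda>x. length x = j) (reduced t)) \<le>
      (\<Sum>r\<in>{j..<n}. length (filter (\<lambda>x. length x \<le> j \<and> last x = Suc r) t))"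
  proof (induction t)
    case (Cons x t)
    have "(if length x = j \<and> x \<noteq> top_col j then 1 else 0) \<le>
        (\<Sum>r\<in>{j..<n}. if length x \<le> j \<and> last x = Suc r then 1 else (0 :: nat))"
    proof (cases "length x = j \<and> x \<noteq> top_col j")
      case True
      have "last x \<noteq> length x" "length x \<le> last x" "last x \<le> n"
        using Cons.prems special_col_eq_top[of x n] True by (auto simp: special_cols_def)
      then have "last x - 1 \<in> {j..<n}" "last x = Suc (last x - 1)" using True by auto
      then have "(if length x \<le> j \<and> last x = Suc (last x - 1) then 1 else 0) \<le>
          (\<Sum>r\<in>{j..<n}. if length x \<le> j \<and> last x = Suc r then 1 else (0 :: nat))"
        by (intro member_le_sum) auto
      with True \<open>last x = Suc (last x - 1)\<close> show ?thesis by simp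
    next
      case False
      then show ?thesis by (subst if_not_P) simp_all
    qed
    moreover have "length (filter (\<lambda>x. length x = j) (reduced (x # t))) =
        (if length x = j \<and> x \<noteq> top_col j then 1 else 0)
        + length (filter (\<lambda>x. length x = j) (reduced t))"
      by (auto simp: reduced_def simp del: upt_Suc)
    moreover have "(\<Sum>r\<in>{j..<n}. length (filter (\<lambda>x. length x \<le> j \<and> last x = Suc r) (x # t))) =
        (\<Sum>r\<in>{j..<n}. if length x \<le> j \<and> last x = Suc r then 1 else 0)
        + (\<Sum>r\<in>{j..<n}. length (filter (\<lambda>x. length x \<le> j \<and> last x = Suc r) t))"
      by (simp flip: sum.distrib add: if_distrib cong: if_cong) (auto intro: sum.cong)
    ultimately show ?case using Cons by simp
  qed (simp add: reduced_def)
  also have "\<dots> = (\<Sum>r\<in>{j..<n}. entry_count j r t)"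
    using cols by (intro sum.cong) (simp_all add: entry_count_special)
  also have "\<dots> = mu j" using w j by (simp add: has_tab_weight_def)
  finally show ?thesis .
qed

text \<open>To the right of a top column of height h, the key allows only greater heights, or height
  h with last entry at most h, which is again a top column.\<close>

lemma special_shape_follows:
  assumes t: "special_shape n lam t"
  shows "[] \<notin> set t" "sorted_wrt (\<lambda>x y. x = top_col (length x) \<longrightarrow> follows (length x) y) t"
proof -
  have cols: "set t \<subseteq> special_cols n" using t by (simp add: special_shape_def)
  then show "[] \<notin> set t" by (auto simp: special_cols_def)
  have "sorted_wrt (\<lambda>x y. col_key n x \<le> col_key n y) t"
    using t by (simp add: special_shape_def sorted_wrt_map)
  then show "sorted_wrt (\<lambda>x y. x = top_col (length x) \<longrightarrow> follows (length x) y) t"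
  proof (rule sorted_wrt_mono_rel[rotated], intro impI)
    fix x y
    assume "x \<in> set t" "y \<in> set t" and le: "col_key n x \<le> col_key n y" and "x = top_col (length x)"
    then have S: "x \<in> special_cols n" "y \<in> special_cols n" and lx: "last x = length x"
      using cols special_col_eq_top[of x n] by blast+
    have ly: "length y \<le> last y" using S by (simp add: special_cols_def)
    have "length x < length y \<or> length x = length y \<and> last y \<le> last x"
      using le by (simp only: col_key_le_iff[OF S])
    then have y: "length x \<le> length y" "length y = length x \<longrightarrow> last y = length y"
      using lx ly by linarith+
    have "butlast y = [1..<length y]" using S by (simp add: special_cols_def)
    moreover have "y = top_col (length x)" if "length y = length x"
    proof -
      have "y = top_col (length y)" using special_col_eq_top[OF S(2)] y(2) that by blast
      then show ?thesis unfolding that .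
    qed
    ultimately show "follows (length x) y" using y unfolding follows_def by blast
  qed
qed

section \<open>Weights of tableaux\<close>

lemma qq_powi_inject: "qq powi a = qq powi b \<Longrightarrow> a = b"
  using qq_gt_1 power_int_strict_increasing[of a b qq] power_int_strict_increasing[of b a qq]
  by (cases a b rule: linorder_cases) auto

lemma K_tab_powi:
  "K_tab i t = qq powi (\<Sum>x\<leftarrow>t. of_bool (i \<in> set x) - of_bool (Suc i \<in> set x))"
  by (induction t) (auto simp: K_col_def power_int_add power_int_minus)

text \<open>The coefficient of alpha_k in varpi_h minus the weight of the column x of height h, that
  is, the sum of its first k epsilon coordinates.\<close>

definition col_weight :: "nat \<Rightarrow> nat list \<Rightarrow> int"
  where "col_weight k x = int (min k (length x)) - int (card {m\<in>set x. m \<le> k})"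

text \<open>The left side counts the entries above k in the top k rows. Since the entry in row r is
  at least r, all entries up to k lie in these rows, and subtracting them from the number of boxes
  there gives the count.\<close>

lemma entry_count_col_weight:
  assumes t: "t \<in> tableaux n lam" and k: "1 \<le> k"
  shows "int (\<Sum>r\<in>{k..<n}. entry_count k r t) = (\<Sum>x\<leftarrow>t. col_weight k x)"
proof -
  have col: "int (\<Sum>r\<in>{k..<n}. count_list (take k x) (Suc r)) = col_weight k x"
    if "x \<in> set t" for x
  proof -
    have x: "set x \<subseteq> {1..n}" "sorted_wrt (<) x" using t that by (auto simp: tableaux_def)
    have "(\<Sum>r\<in>{k..<n}. count_list y (Suc r)) = length (filter (\<lambda>m. k < m) y)"
      if "set y \<subseteq> {1..n}" for y
      using that
    proof (induction y)
      case (Cons m y)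
      have "(\<Sum>r\<in>{k..<n}. if m = Suc r then 1 else 0) = (if k < m then 1 else (0 :: nat))"
        using Cons.prems by (cases m) auto
      moreover have "(\<Sum>r\<in>{k..<n}. count_list (m # y) (Suc r)) =
          (\<Sum>r\<in>{k..<n}. if m = Suc r then 1 else 0) + (\<Sum>r\<in>{k..<n}. count_list y (Suc r))"
        by (simp flip: sum.distrib) (auto intro: sum.cong)
      ultimately show ?case using Cons by simp
    qed simp
    then have "(\<Sum>r\<in>{k..<n}. count_list (take k x) (Suc r)) = length (filter (\<lambda>m. k < m) (take k x))"
      using x set_take_subset[of k x] by blast
    moreover have "length (filter (\<lambda>m. k < m) y) + length (filter (\<lambda>m. m \<le> k) y) = length y" for y
      by (induction y) auto
    moreover have "filter (\<lambda>m. m \<le> k) (take k x) = filter (\<lambda>m. m \<le> k) x"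
    proof -
      have "filter (\<lambda>m. m \<le> k) (drop k x) = []"
      proof -
        have "k < m" if m: "m \<in> set (drop k x)" for m
        proof -
          obtain i where i: "i < length x - k" "m = x ! (k + i)"
            using m by (auto simp: in_set_conv_nth)
          have "set x \<subseteq> {1..}" using x(1) by auto
          moreover have "k + i < length x" using i(1) by simp
          ultimately have "Suc (k + i) \<le> x ! (k + i)" by (rule strict_col_nth_ge[OF x(2)])
          then show ?thesis using i(2) by linarith
        qed
        then have "\<forall>m\<in>set (drop k x). \<not> m \<le> k" by (meson leD)
        then show ?thesis by (rule filter_False)
      qed
      then have "filter (\<lambda>m. m \<le> k) (take k x @ drop k x) = filter (\<lambda>m. m \<le> k) (take k x)"
        by (simp only: filter_append append_Nil2)
      then show ?thesis by simp
    qed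
    moreover have "length (filter (\<lambda>m. m \<le> k) x) = card {m\<in>set x. m \<le> k}"
      using distinct_card[of "filter (\<lambda>m. m \<le> k) x"] x(2) by (simp add: strict_sorted_iff)
    ultimately show ?thesis
      unfolding col_weight_def by (metis length_take add_diff_cancel_right' min.commute of_nat_add)
  qed
  have "int (\<Sum>r\<in>{k..<n}. entry_count k r t) =
      (\<Sum>x\<leftarrow>t. int (\<Sum>r\<in>{k..<n}. count_list (take k x) (Suc r)))"
    unfolding entry_count_def by (induction t) (simp_all add: sum.distrib)
  also have "\<dots> = (\<Sum>x\<leftarrow>t. col_weight k x)"
    using col by (intro arg_cong[of _ _ sum_list] map_cong) simp_all
  finally show ?thesis .
qed

text \<open>Second differences are pairings with a simple root: the right side is the pairing of
  alpha_k with the fundamental weight given by the height, minus that with the weight of the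
  column.\<close>

lemma col_weight_laplacian:
  assumes "1 \<le> k"
  shows "2 * col_weight k x - col_weight (k - 1) x - col_weight (Suc k) x =
    of_bool (length x = k) - (of_bool (k \<in> set x) - of_bool (Suc k \<in> set x))"
proof -
  have step: "int (card {m\<in>set x. m \<le> Suc j}) = int (card {m\<in>set x. m \<le> j}) + of_bool (Suc j \<in> set x)" for j
  proof -
    have "{m\<in>set x. m \<le> Suc j} = {m\<in>set x. m \<le> j} \<union> (if Suc j \<in> set x then {Suc j} else {})"
      by (auto simp: le_Suc_eq)
    then show ?thesis by (simp add: card_insert_if)
  qed
  obtain j where k: "k = Suc j" using assms by (cases k) auto
  show ?thesis unfolding k col_weight_def step by (auto simp: step min_def)
qed

text \<open>Extending mu by zero to 0 and n makes the three-term formula hold at the ends i = 1 and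
  i = n - 1 as well.\<close>

lemma root_pairing_laplacian:
  assumes "i \<in> {1..<n}" and mu': "\<And>j. mu' j = (if j \<in> {1..<n} then int (mu j) else 0)"
  shows "root_pairing n i mu = 2 * mu' i - mu' (i - 1) - mu' (Suc i)"
proof -
  have "root_pairing n i mu = (\<Sum>j\<in>{1..<n}. mu' j * cartan i j)"
    unfolding root_pairing_def by (intro sum.cong) (simp_all add: mu')
  also have "\<dots> = (\<Sum>j\<in>{0..n}. mu' j * cartan i j)"
    by (intro sum.mono_neutral_left) (auto simp: mu')
  also have "\<dots> = (\<Sum>j\<in>{i - 1, i, Suc i}. mu' j * cartan i j)"
    using assms by (intro sum.mono_neutral_right) (auto simp: cartan_def)
  also have "\<dots> = 2 * mu' i - mu' (i - 1) - mu' (Suc i)"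
    using assms(1) by (cases i) (simp_all add: cartan_def)
  finally show ?thesis .
qed

text \<open>Nondegeneracy of the Cartan matrix: vanishing second differences make X linear, and the
  two boundary zeros force it to vanish.\<close>

lemma harmonic_zero:
  fixes X :: "nat \<Rightarrow> int"
  assumes "X 0 = 0" "X n = 0" and harmonic: "\<And>k. k \<in> {1..<n} \<Longrightarrow> 2 * X k = X (k - 1) + X (Suc k)"
    and "k \<le> n"
  shows "X k = 0"
proof -
  have linear: "X k = int k * X 1 \<and> X (Suc k) = int (Suc k) * X 1" if "Suc k \<le> n" for k
    using that
  proof (induction k)
    case (Suc k)
    then show ?case using harmonic[of "Suc k"] by (simp add: algebra_simps)
  qed (simp add: assms(1))
  show ?thesis
  proof (cases n)
    case (Suc m)
    then have "X 1 = 0" using linear[of m] assms(2) by simp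
    then show ?thesis using linear[of "k - 1"] assms by (cases k) auto
  qed (use assms in simp)
qed

text \<open>As the coefficient is nonzero, each K_i has the same eigenvalue on t as on v. This fixes
  the second differences of nu, and with the boundary values nu itself.\<close>

lemma has_tab_weight_if_coef_nonzero:
  assumes v: "v \<in> vec_wt_space n lam mu" and nz: "coef v t \<noteq> 0" and t: "t \<in> tableaux n lam"
  shows "has_tab_weight n mu t"
proof -
  define nu where "nu k = (\<Sum>x\<leftarrow>t. col_weight k x)" for k
  define mu' where "mu' j = (if j \<in> {1..<n} then int (mu j) else 0)" for j
  have coef_K: "coef (gen_act (GenK i) v) t = K_tab i t * coef v t" for i
    by (induction v rule: poly_mapping_add_induct)
      (auto simp: gen_act_linear lookup_add lookup_single when_def distrib_left)
  have len: "map length t = column_heights n lam" using t by (simp add: tableaux_def)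
  have lap: "2 * nu i - nu (i - 1) - nu (Suc i) = root_pairing n i mu" if i: "i \<in> {1..<n}" for i
  proof -
    have "gen_act (GenK i) v = vscale (qq powi (int (lam i) - root_pairing n i mu)) v"
      using v i by (simp add: vec_wt_space_def vec_has_weight_def)
    then have "K_tab i t = qq powi (int (lam i) - root_pairing n i mu)"
      using coef_K[of i] nz by simp
    then have K: "(\<Sum>x\<leftarrow>t. of_bool (i \<in> set x) - of_bool (Suc i \<in> set x)) = int (lam i) - root_pairing n i mu"
      unfolding K_tab_powi by (rule qq_powi_inject)
    have "int (lam i) = int (count (mset (map length t)) i)"
      using i by (simp only: len count_column_heights) simp
    also have "\<dots> = (\<Sum>x\<leftarrow>t. of_bool (length x = i))"
      unfolding count_map_length by (induction t) auto
    finally have "(\<Sum>x\<leftarrow>t. of_bool (length x = i)) = int (lam i)" ..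
    moreover have "2 * nu i - nu (i - 1) - nu (Suc i) =
        (\<Sum>x\<leftarrow>t. 2 * col_weight i x - col_weight (i - 1) x - col_weight (Suc i) x)"
      unfolding nu_def by (induction t) simp_all
    moreover have "\<dots> = (\<Sum>x\<leftarrow>t. of_bool (length x = i)) -
        (\<Sum>x\<leftarrow>t. of_bool (i \<in> set x) - of_bool (Suc i \<in> set x))"
      using i by (simp only: col_weight_laplacian atLeastLessThan_iff) (simp add: sum_list_subtractf)
    ultimately show ?thesis using K by simp
  qed
  have cols: "set x \<subseteq> {1..n} \<and> distinct x \<and> length x < n" if "x \<in> set t" for x
  proof -
    have "length x \<in> {1..<n}"
      using that set_column_heights[of n lam] by (auto simp flip: len)
    then show ?thesis using t that by (auto simp: tableaux_def strict_sorted_iff)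
  qed
  \<comment> \<open>Boundary values: no entry is below 1, and at k = n all boxes and all entries are
    counted, because heights stay below n.\<close>
  have "nu 0 = 0"
  proof -
    have "col_weight 0 x = 0" if "x \<in> set t" for x
    proof -
      have "{m\<in>set x. m \<le> 0} = {}" using cols[OF that] by fastforce
      then show ?thesis by (simp add: col_weight_def)
    qed
    then show ?thesis unfolding nu_def by (simp cong: map_cong)
  qed
  moreover have "nu n = 0"
  proof -
    have "col_weight n x = 0" if "x \<in> set t" for x
    proof -
      have "{m\<in>set x. m \<le> n} = set x" using cols[OF that] by fastforce
      then show ?thesis using cols[OF that] by (simp add: col_weight_def distinct_card)
    qed
    then show ?thesis unfolding nu_def by (simp cong: map_cong)
  qed
  moreover have "2 * (nu k - mu' k) = (nu (k - 1) - mu' (k - 1)) + (nu (Suc k) - mu' (Suc k))"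
    if "k \<in> {1..<n}" for k
    using lap[OF that] root_pairing_laplacian[OF that, of mu' mu] by (simp add: mu'_def)
  ultimately have zero: "nu k - mu' k = 0" if "k \<le> n" for k
    using harmonic_zero[of "\<lambda>k. nu k - mu' k" n k] that by (simp add: mu'_def)
  show ?thesis
    unfolding has_tab_weight_def
  proof
    fix k
    assume k: "k \<in> {1..<n}"
    then have "int (\<Sum>r\<in>{k..<n}. entry_count k r t) = nu k"
      using entry_count_col_weight[OF t] by (simp add: nu_def)
    also have "\<dots> = int (mu k)" using zero[of k] k by (simp add: mu'_def)
    finally show "(\<Sum>r\<in>{k..<n}. entry_count k r t) = mu k" by (simp only: of_nat_eq_iff)
  qed
qed

section \<open>Comparison of two large weights\<close>

lemma free_act_F_words_eq:
  assumes "p \<in> F_words n"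
    and "\<And>w. set w \<subseteq> GenF ` {1..} \<Longrightarrow> coef (word_act w v) t = coef (word_act w v') t'"
  shows "coef (free_act p v) t = coef (free_act p v') t'"
proof -
  have "coef (word_act (letters w) v) t = coef (word_act (letters w) v') t'"
    if "w \<in> Poly_Mapping.keys p" for w
    using assms(1) that by (intro assms(2)) (force simp: F_words_def)
  then show ?thesis
    unfolding free_act_superset[OF finite_keys order_refl]
    by (simp add: lookup_sum)
qed

text \<open>Both coefficients equal the one at the common remaining tableau, with top columns of its
  own heights as source; neither shape occurs in it any more.\<close>

lemma coef_eq_if_reduced_eq:
  assumes "u \<in> UminusZ n" "special_shape n lam t" "special_shape n lam' t'" "reduced t = reduced t'"
  shows "coef (uq_act u (highest_vec n lam)) t = coef (uq_act u (highest_vec n lam')) t'"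
proof -
  from assms(1) obtain p where p: "p \<in> F_words n" "u = uq_class n p" by (rule UminusZ_F_words)
  have shapes: "map length t = column_heights n lam" "map length t' = column_heights n lam'"
    using special_shapeD(1)[OF assms(2)] special_shapeD(1)[OF assms(3)]
    by (simp_all add: std_tableaux_def tableaux_def)
  show ?thesis
    unfolding p(2) uq_act_class
    using special_shape_follows[OF assms(2)] special_shape_follows[OF assms(3)] shapes assms(4)
    by (intro free_act_F_words_eq[OF p(1)]) (simp add: word_act_reduced)
qed

text \<open>
  Otherwise a monomial in the F's of weight - mu ending in the mu k-th power of F with index k would be
  a nonzero element killing the highest weight vector.
\<close>

lemma identified_weight_ge:
  assumes ident: "lattices_identified n lam mu" and k: "k \<in> {1..<n}"
  shows "mu k \<le> lam k"
proof (rule ccontr)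
  assume less: "\<not> mu k \<le> lam k"
  define js where "js = filter (\<lambda>j. j \<noteq> k) [1..<n]"
  \<comment> \<open>The power of F_k stands at the right end, so that it is applied first to the
    highest weight vector.\<close>
  define ks where "ks = concat (map (\<lambda>j. replicate (mu j) j) js) @ replicate (mu k) k"
  define u where "u = uq_class n (F_monomial ks)"
  have ks: "set ks \<subseteq> {1..<n}" using k by (auto simp: ks_def js_def)
  have "(\<Sum>j\<leftarrow>ks. cartan i j) = root_pairing n i mu" for i
  proof -
    have "(\<Sum>j\<leftarrow>concat (map (\<lambda>j. replicate (mu j) j) xs). cartan i j) = (\<Sum>j\<leftarrow>xs. int (mu j) * cartan i j)" for xs
      by (induction xs) (simp_all add: sum_list_replicate)
    then have "(\<Sum>j\<leftarrow>ks. cartan i j) = (\<Sum>j\<leftarrow>js. int (mu j) * cartan i j) + int (mu k) * cartan i k"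
      by (simp add: ks_def sum_list_replicate)
    also have "(\<Sum>j\<leftarrow>js. int (mu j) * cartan i j) = (\<Sum>j\<in>{1..<n} - {k}. int (mu j) * cartan i j)"
      unfolding js_def by (subst sum_list_distinct_conv_sum_set) (auto intro: sum.cong)
    finally show ?thesis
      unfolding root_pairing_def using k by (subst sum.remove[of _ k]) simp_all
  qed
  then have "uq_has_weight n (\<lambda>i. - root_pairing n i mu) u"
    unfolding uq_has_weight_def u_def using K_F_monomial[OF ks] ks
    by (simp add: uq_class_mult uq_scale_class F_monomial_carrier)
  moreover have "u \<in> UminusZ n" unfolding u_def using ks by (rule F_monomial_UminusZ)
  ultimately have u: "u \<in> UminusZ n \<inter> uq_wt_space n mu" by (simp add: uq_wt_space_def)
  have "\<zero>\<^bsub>Uq n\<^esub> \<in> UminusZ n"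
    unfolding UminusZ_def by (rule ring.zero_in_generate[OF ring_Uq])
  \<comment> \<open>Injectivity will compare u with zero, which must therefore lie in the same
    weight space.\<close>
  moreover have "uq_has_weight n nu (\<zero>\<^bsub>Uq n\<^esub>)" for nu
    by (simp add: uq_has_weight_def uq_class_zero uq_class_mult uq_scale_class)
  ultimately have zero: "\<zero>\<^bsub>Uq n\<^esub> \<in> UminusZ n \<inter> uq_wt_space n mu" by (simp add: uq_wt_space_def)
  let ?s = "map top_col (column_heights n lam)"
  have count: "length (filter (\<lambda>j. j = k) xs) = count (mset xs) k" for xs
    by (induction xs) auto
  \<comment> \<open>F_k can act only on top columns of height k, so the number of usable columns is
    lam k.\<close>
  have "k \<in> set (top_col j) \<and> Suc k \<notin> set (top_col j) \<longleftrightarrow> j = k" for j using k by auto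
  then have "filter (\<lambda>x. k \<in> set x \<and> Suc k \<notin> set x) ?s = map top_col (filter (\<lambda>j. j = k) (column_heights n lam))"
    by (simp only: filter_map comp_def)
  then have "length (filter (\<lambda>x. k \<in> set x \<and> Suc k \<notin> set x) ?s) = count (mset (column_heights n lam)) k"
    using count[of "column_heights n lam"] by (simp del: upt_Suc)
  also have "\<dots> = lam k" using k by (simp add: count_column_heights)
  finally have "word_act (replicate (mu k) (GenF k)) (highest_vec n lam) = 0"
    unfolding highest_vec_def using less by (intro F_power_vanishes) simp
  then have "uq_act u (highest_vec n lam) = 0"
    by (simp add: u_def uq_act_class free_act_F_monomial ks_def word_act_linear)
  moreover have "uq_act (\<zero>\<^bsub>Uq n\<^esub>) (highest_vec n lam) = 0" by (simp add: uq_class_zero uq_act_class)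
  moreover have "inj_on (\<lambda>u. uq_act u (highest_vec n lam)) (UminusZ n \<inter> uq_wt_space n mu)"
    using ident by (simp add: lattices_identified_def bij_betw_def)
  ultimately have "u = \<zero>\<^bsub>Uq n\<^esub>" using u zero by (simp add: inj_on_def)
  with F_monomial_nonzero[OF ks] show False by (simp add: u_def)
qed

text \<open>Standard tableaux of another weight have coefficient 0 in a weight vector; those of
  weight mu are special and have a partner of the other shape with the same remaining columns. The
  converse arises by exchanging the two weights.\<close>

lemma is_dual_vec_transfer:
  assumes large: "large_weight n lam mu" and large': "large_weight n lam' mu"
    and s: "special_shape n lam s" and s': "special_shape n lam' s'" and red: "reduced s = reduced s'"
    and s'_weight: "has_tab_weight n mu s'"
    and u: "u \<in> LZ_inf n \<inter> uq_wt_space n mu"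
    and dual: "is_dual_vec n lam s (uq_act u (highest_vec n lam))"
  shows "is_dual_vec n lam' s' (uq_act u (highest_vec n lam'))"
  unfolding is_dual_vec_def
proof (intro conjI ballI)
  have uZ: "u \<in> UminusZ n" using u by (simp add: LZ_inf_def)
  have image: "uq_act u (highest_vec n lam') \<in> LZ_mod n lam' \<inter> vec_wt_space n lam' mu"
    using large' u unfolding large_weight_def lattices_identified_def by blast
  then show "uq_act u (highest_vec n lam') \<in> LZ_mod n lam'" by simp
  fix t'
  assume t': "t' \<in> std_tableaux n lam'"
  show "coef (uq_act u (highest_vec n lam')) t' = (if t' = s' then 1 else 0)"
  proof (cases "has_tab_weight n mu t'")
    case False
    then have "coef (uq_act u (highest_vec n lam')) t' = 0"
      using has_tab_weight_if_coef_nonzero[of _ n lam' mu t'] image t' by (auto simp: std_tableaux_def)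
    with False s'_weight show ?thesis by auto
  next
    case True
    with large' t' have "special t'" by (simp add: large_weight_def)
    with t' have shape': "special_shape n lam' t'" by (rule special_shapeI)
    \<comment> \<open>Room for the partner: at most mu j remaining columns have height j, and mu j
      \<le> lam j.\<close>
    have "length (filter (\<lambda>x. length x = j) (reduced t')) \<le> lam j" if "j \<in> {1..<n}" for j
      using reduced_height_le_weight[OF shape' True that] identified_weight_ge[OF _ that, of lam mu] large
      by (simp add: large_weight_def)
    then obtain t where t: "special_shape n lam t" "reduced t = reduced t'"
      by (rule special_shape_exists[OF shape'])
    have "t = s \<longleftrightarrow> t' = s'"
      using special_shape_unique[OF t(1) s] special_shape_unique[OF shape' s'] t(2) red by auto
    moreover have "coef (uq_act u (highest_vec n lam)) t = (if t = s then 1 else 0)"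
      using dual special_shapeD(1)[OF t(1)] by (simp add: is_dual_vec_def)
    ultimately show ?thesis
      using coef_eq_if_reduced_eq[OF uZ t(1) shape' t(2)] by simp
  qed
qed

theorem proposition5p1:
  fixes n :: nat and mu lam lam' :: "nat \<Rightarrow> nat" and sigma sigma' :: tableau
  assumes "n \<ge> 2"
    and "large_weight n lam mu"
    and "large_weight n lam' mu"
    and "sigma \<in> std_tableaux n lam" and "has_tab_weight n mu sigma"
    and "sigma' \<in> std_tableaux n lam'" and "has_tab_weight n mu sigma'"
    and "\<forall>k r. 1 \<le> k \<and> k \<le> r \<and> r \<le> n - 1 \<longrightarrow> entry_count k r sigma = entry_count k r sigma'"
  shows "dual_elt n lam mu sigma = dual_elt n lam' mu sigma'"
proof -
  have shape: "special_shape n lam sigma" "special_shape n lam' sigma'"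
    using assms(2-7) by (auto intro: special_shapeI simp: large_weight_def)
  then have red: "reduced sigma = reduced sigma'"
    using assms(8) by (intro reduced_eq_if_entry_count_eq) auto
  have "is_dual_vec n lam sigma (uq_act u (highest_vec n lam)) \<longleftrightarrow>
      is_dual_vec n lam' sigma' (uq_act u (highest_vec n lam'))"
    if "u \<in> LZ_inf n \<inter> uq_wt_space n mu" for u
    using is_dual_vec_transfer[OF assms(2,3) shape red assms(7) that]
      is_dual_vec_transfer[OF assms(3,2) shape(2,1) red[symmetric] assms(5) that] by blast
  \<comment> \<open>Both elements are definite descriptions over the same set, on which the
    describing conditions are equivalent.\<close>
  then show ?thesis unfolding dual_elt_def by metis
qed

end
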